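(* Let $\mathcal{A}$ be a compact Hausdorff alphabet with finitely many accumulation points and let $\tau$ be an $\infty$-reduced substitution on $\mathcal{A}$, with substitution operator $M$. Let $\overline{\tau}$ be the restriction of $\tau$ to the finite alphabet $\mathcal{A}^{(\infty)}$ of accumulation points and let $M_\infty$ be the substitution operator of $\overline{\tau}$. Then, for all $n\in\mathbb{N}$, $$\|M^n\|_{\mathrm{ess}}\le\|M^n\|=\|M_\infty^n\|=\max_{a\in\mathcal{A}^{(\infty)}}\#\overline{\tau}^n(a).$$ In particular, $r_{\mathrm{ess}}(M)\le r(M)=r(M_\infty)$. Suppose, additionally, that $\tau$ maps isolated points to words consisting only of isolated points or, more generally, that for all $n\in\mathbb{N}$, all accumulation points $\infty_i$ and all open neighbourhoods $U$ of $\infty_i$, there exists some $a\in U$ such that $\tau^n(a)$ consists only of isolated points. Then the inequality above is an equality, i.e. $\|M^n\|_{\mathrm{ess}}=\|M^n\|$ for all $n\in\mathbb{N}$. Hence, in this case, $r_{\mathrm{ess}}(M)=r(M_\infty)$.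
   Context: Substitutions: $\mathcal{A}$ is a non-empty compact Hausdorff space, $\mathcal{A}^\ast=\bigsqcup_{i\ge0}\mathcal{A}^i$ the space of finite words (product topologies, disjoint union topology, $\varepsilon$ the empty word), $\#u$ the length of $u$, and $b\triangleleft u$ means that the letter $b$ occurs in $u$. A substitution is a continuous map $\tau\colon\mathcal{A}\to\mathcal{A}^\ast$ (letters may be sent to $\varepsilon$; no growth assumption is made on $\tau$ here), extended by concatenation to $\mathcal{A}^\ast$. The order of letters is irrelevant here, so $\tau$ may equally be a multiset substitution: a continuous map from $\mathcal{A}$ to the space $\bigsqcup_i\mathcal{A}^i/S_i$ of finite multisets, extended additively to multisets; $\triangleleft$ and $\#$ (with multiplicity) retain their meanings. Operators: $E=C(\mathcal{A})$ (real continuous functions, sup norm). The substitution operator is $(Mf)(a)=\sum_{b\triangleleft\tau(a)}f(b)$ (sum with multiplicity). $r$ is spectral radius. $\|M\|_{\mathrm{ess}}=\inf\{\|M-V\|:V\text{ compact operator on }E\}$ and $r_{\mathrm{ess}}(M)=\lim_n\|M^n\|_{\mathrm{ess}}^{1/n}$. $\infty$-reduced: a letter $a$ is isolated if $\{a\}$ is open, otherwise it is an accumulation point. Let $\mathcal{A}^{(\infty)}=\{\infty_1,\dots,\infty_m\}$ be the set of accumulation points (if it is empty, the maximum above is read as $0$). $\tau$ is $\infty$-reduced if there are open neighbourhoods $U_i$ of $\infty_i$ such that: (1) the $U_i$ are mutually disjoint; (2) $\tau(p)=\varepsilon$ for all $p\in\mathcal{A}\setminus(U_1\cup\dots\cup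 U_m)$; (3) for all $i$ and all $b\in\mathcal{A}$ there is no open neighbourhood $U_i'\subseteq U_i$ of $\infty_i$ with $b\triangleleft\tau(u)$ for all $u\in U_i'$; (4) for all $i$ and $a\in U_i$, $\#\tau(a)\le\#\tau(\infty_i)$ and, for all $i,j$ and $u\in U_i$, the number of occurrences of letters of $U_j$ in $\tau(u)$ is at most the number of occurrences of $\infty_j$ in $\tau(\infty_i)$. In this case each $\tau(\infty_i)$ consists only of accumulation points, and $\overline{\tau}$ is the substitution on $\mathcal{A}^{(\infty)}$ given by $\overline{\tau}(\infty_i)=\tau(\infty_i)$. *)

theory Defs
  imports "HOL-Analysis.Analysis" "HOL-Library.Multiset"
begin

section \<open>Spaces of words and of finite multisets\<close>

text \<open>The space of words is the disjoint union of the powers \<open>A\<^sup>i\<close>: a set of lists is open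
  iff its preimage in every \<open>A\<^sup>i\<close> (product topology; tuples are extensional functions on
  \<open>{..<i}\<close>) is open. The space of finite multisets is the disjoint union of the quotients
  \<open>A\<^sup>i / S\<^sub>i\<close>, which leads to the same definition with \<open>mset\<close> applied to the tuple.\<close>

definition tuple_topology :: "nat \<Rightarrow> (nat \<Rightarrow> 'a::topological_space) topology" where
  "tuple_topology i = product_topology (\<lambda>_. euclidean) {..<i}"

definition word_open :: "'a::topological_space list set \<Rightarrow> bool" where
  "word_open W \<longleftrightarrow>
     (\<forall>i. openin (tuple_topology i) {x \<in> topspace (tuple_topology i). map x [0..<i] \<in> W})"

definition mset_open :: "'a::topological_space multiset set \<Rightarrow> bool" where
  "mset_open W \<longleftrightarrow>
     (\<forall>i. openin (tuple_topology i) {x \<in> topspace (tuple_topology i). mset (map x [0..<i]) \<in> W})"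

lemma istopology_word_open: "istopology word_open"
proof -
  have "word_open (S \<inter> T)" if "word_open S" "word_open T" for S T :: "'a list set"
    unfolding word_open_def
  proof
    fix i
    have "{x \<in> topspace (tuple_topology i). map x [0..<i] \<in> S \<inter> T} =
        {x \<in> topspace (tuple_topology i). map x [0..<i] \<in> S} \<inter>
        {x \<in> topspace (tuple_topology i). map x [0..<i] \<in> T}" by blast
    then show "openin (tuple_topology i) {x \<in> topspace (tuple_topology i). map x [0..<i] \<in> S \<inter> T}"
      using that by (simp only: word_open_def openin_Int)
  qed
  moreover have "word_open (\<Union>\<K>)" if "\<forall>K\<in>\<K>. word_open K" for \<K> :: "'a list set set"
    unfolding word_open_def
  proof
    fix i
    have "{x \<in> topspace (tuple_topology i). map x [0..<i] \<in> \<Union>\<K>} =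
        (\<Union>K\<in>\<K>. {x \<in> topspace (tuple_topology i). map x [0..<i] \<in> K})" by blast
    then show "openin (tuple_topology i) {x \<in> topspace (tuple_topology i). map x [0..<i] \<in> \<Union>\<K>}"
      using that by (auto simp only: word_open_def intro!: openin_Union)
  qed
  ultimately show ?thesis by (auto simp: istopology_def)
qed

lemma istopology_mset_open: "istopology mset_open"
proof -
  have "mset_open W \<longleftrightarrow> word_open (mset -` W)" for W :: "'a multiset set"
    by (simp add: mset_open_def word_open_def)
  moreover have "mset -` (\<Union>\<K>) = \<Union>((-`) mset ` \<K>)" for \<K> :: "'a multiset set set"
    by blast
  ultimately show ?thesis
    using istopology_word_open[where ?'a = 'a]
    by (auto simp: istopology_def vimage_Int)
qed

definition word_topology :: "'a::topological_space list topology" where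
  "word_topology = topology word_open"

definition mset_topology :: "'a::topological_space multiset topology" where
  "mset_topology = topology mset_open"

lemma openin_word_topology [simp]: "openin word_topology W \<longleftrightarrow> word_open W"
  by (simp add: word_topology_def istopology_word_open topology_inverse')

lemma openin_mset_topology [simp]: "openin mset_topology W \<longleftrightarrow> mset_open W"
  by (simp add: mset_topology_def istopology_mset_open topology_inverse')

lemma topspace_word_topology [simp]: "topspace word_topology = UNIV"
proof -
  have "openin word_topology (UNIV :: 'a list set)"
    by (simp add: word_open_def)
  then show ?thesis by (meson openin_subset top.extremum_uniqueI)
qed

lemma topspace_mset_topology [simp]: "topspace mset_topology = UNIV"
proof -
  have "openin mset_topology (UNIV :: 'a multiset set)"
    by (simp add: mset_open_def)
  then show ?thesis by (meson openin_subset top.extremum_uniqueI)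
qed


section \<open>Substitutions\<close>

definition word_substitution :: "('a::topological_space \<Rightarrow> 'a list) \<Rightarrow> bool" where
  "word_substitution \<sigma> \<longleftrightarrow> continuous_map euclidean word_topology \<sigma>"

definition mset_substitution :: "('a::topological_space \<Rightarrow> 'a multiset) \<Rightarrow> bool" where
  "mset_substitution \<tau> \<longleftrightarrow> continuous_map euclidean mset_topology \<tau>"

text \<open>The order of the letters being irrelevant, a substitution given by words enters through the
  multisets \<open>mset (\<sigma> a)\<close> of letters of its images. Occurrence of a letter, length and number of
  occurrences are then \<open>\<in>#\<close>, \<open>size\<close> and \<open>count\<close>.\<close>

definition substitution :: "('a::topological_space \<Rightarrow> 'a multiset) \<Rightarrow> bool" where
  "substitution \<tau> \<longleftrightarrow> mset_substitution \<tau> \<or> (\<exists>\<sigma>. word_substitution \<sigma> \<and> \<tau> = mset \<circ> \<sigma>)"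

definition subst_ext :: "('a \<Rightarrow> 'a multiset) \<Rightarrow> 'a multiset \<Rightarrow> 'a multiset" where
  "subst_ext \<tau> m = (\<Sum>b\<in>#m. \<tau> b)"

definition subst_iter :: "('a \<Rightarrow> 'a multiset) \<Rightarrow> nat \<Rightarrow> 'a \<Rightarrow> 'a multiset" where
  "subst_iter \<tau> n a = (subst_ext \<tau> ^^ n) {#a#}"

lemma subst_iter_word:
  "subst_iter (mset \<circ> \<sigma>) n a = mset (((\<lambda>w. concat (map \<sigma> w)) ^^ n) [a])"
proof (induction n)
  case (Suc n)
  have "subst_ext (mset \<circ> \<sigma>) (mset w) = mset (concat (map \<sigma> w))" for w
    by (induction w) (auto simp: subst_ext_def)
  from this[of "((\<lambda>w. concat (map \<sigma> w)) ^^ n) [a]"] Suc show ?case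
    by (simp add: subst_iter_def del: o_apply) (simp add: o_def)
qed (simp add: subst_iter_def)

lemma word_substitution_imp_mset_substitution:
  "word_substitution \<sigma> \<Longrightarrow> mset_substitution (mset \<circ> \<sigma>)"
proof -
  assume "word_substitution \<sigma>"
  moreover have "continuous_map word_topology mset_topology mset"
    by (simp add: continuous_map_def word_open_def mset_open_def)
  ultimately show ?thesis
    unfolding word_substitution_def mset_substitution_def by (rule continuous_map_compose)
qed


section \<open>Accumulation points and \<open>\<infinity>\<close>-reduced substitutions\<close>

definition isolated :: "'a::topological_space \<Rightarrow> bool" where
  "isolated a \<longleftrightarrow> open {a}"

definition acc_points :: "'a::topological_space set" where
  "acc_points = {a. \<not> isolated a}"

text \<open>The neighbourhoods \<open>U\<^sub>i\<close> are indexed by the accumulation points themselves. In the last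
  condition the filtered multiset consists of the occurrences in \<open>\<tau> u\<close> of letters of \<open>U q\<close>.\<close>

definition infty_reduced :: "('a::topological_space \<Rightarrow> 'a multiset) \<Rightarrow> bool" where
  "infty_reduced \<tau> \<longleftrightarrow> (\<exists>U :: 'a \<Rightarrow> 'a set.
     (\<forall>p\<in>acc_points. open (U p) \<and> p \<in> U p) \<and>
     (\<forall>p\<in>acc_points. \<forall>q\<in>acc_points. p \<noteq> q \<longrightarrow> U p \<inter> U q = {}) \<and>
     (\<forall>a. a \<notin> (\<Union>p\<in>acc_points. U p) \<longrightarrow> \<tau> a = {#}) \<and>
     (\<forall>p\<in>acc_points. \<forall>b. \<not> (\<exists>U'. open U' \<and> p \<in> U' \<and> U' \<subseteq> U p \<and> (\<forall>u\<in>U'. b \<in># \<tau> u))) \<and>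
     (\<forall>p\<in>acc_points. \<forall>a\<in>U p. size (\<tau> a) \<le> size (\<tau> p)) \<and>
     (\<forall>p\<in>acc_points. \<forall>q\<in>acc_points. \<forall>u\<in>U p.
        size {#b \<in># \<tau> u. b \<in> U q#} \<le> count (\<tau> p) q))"

definition acc_subst :: "('a::topological_space \<Rightarrow> 'a multiset) \<Rightarrow> 'a \<Rightarrow> 'a multiset" where
  "acc_subst \<tau> a = (if a \<in> acc_points then \<tau> a else {#})"


section \<open>The substitution operators\<close>

text \<open>For a compact alphabet the type \<open>'a \<Rightarrow>\<^sub>C real\<close> of bounded continuous functions is \<open>C(A)\<close> with
  the sup norm. \<open>Blinfun\<close> and \<open>Bcontfun\<close> are only meaningful on bounded linear maps and bounded
  continuous functions; this is guaranteed by \<open>subst_op_apply\<close> below.\<close>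

definition subst_op ::
    "('a::topological_space \<Rightarrow> 'a multiset) \<Rightarrow> ('a \<Rightarrow>\<^sub>C real) \<Rightarrow>\<^sub>L ('a \<Rightarrow>\<^sub>C real)" where
  "subst_op \<tau> = Blinfun (\<lambda>f. Bcontfun (\<lambda>a. \<Sum>b\<in>#\<tau> a. apply_bcontfun f b))"

lemma continuous_on_sum_subst:
  fixes f :: "'a::topological_space \<Rightarrow> real"
  assumes "mset_substitution \<tau>" and f: "continuous_on UNIV f"
  shows "continuous_on UNIV (\<lambda>a. \<Sum>b\<in>#\<tau> a. f b)"
proof -
  have eq: "(\<Sum>b\<in>#mset (map x [0..<i]). f b) = (\<Sum>j<i. f (x j))" for x i
    by (induction i) auto
  have *: "continuous_map (tuple_topology i) euclideanreal (\<lambda>x. \<Sum>j<i. f (x j))" for i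
  proof (rule continuous_map_sum)
    fix j assume "j \<in> {..<i}"
    then have "continuous_map (tuple_topology i) euclidean (\<lambda>x. x j)"
      unfolding tuple_topology_def by (rule continuous_map_product_projection)
    moreover have "continuous_map euclidean euclideanreal f" using f by simp
    ultimately show "continuous_map (tuple_topology i) euclideanreal (\<lambda>x. f (x j))"
      using continuous_map_compose[of "tuple_topology i" euclidean "\<lambda>x. x j" euclideanreal f]
      by (simp add: o_def)
  qed simp
  have "continuous_map mset_topology euclideanreal (\<lambda>m. \<Sum>b\<in>#m. f b)"
    unfolding continuous_map_def openin_mset_topology mset_open_def topspace_mset_topology
  proof (intro conjI allI impI)
    fix V :: "real set" and i assume "openin euclidean V"
    then have "openin (tuple_topology i) {x \<in> topspace (tuple_topology i). (\<Sum>j<i. f (x j)) \<in> V}"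
      using * unfolding continuous_map_def by blast
    then show "openin (tuple_topology i) {x \<in> topspace (tuple_topology i).
        mset (map x [0..<i]) \<in> {m \<in> UNIV. (\<Sum>b\<in>#m. f b) \<in> V}}"
      by (simp only: mem_Collect_eq eq UNIV_I simp_thms)
  qed simp
  with assms(1) show ?thesis
    unfolding mset_substitution_def
    using continuous_map_compose[of euclidean mset_topology \<tau> euclideanreal "\<lambda>m. \<Sum>b\<in>#m. f b"]
    by (simp add: o_def)
qed

lemma sum_mset_abs_le:
  fixes f :: "'a \<Rightarrow> real"
  assumes "\<And>b. \<bar>f b\<bar> \<le> B"
  shows "\<bar>\<Sum>b\<in>#m. f b\<bar> \<le> real (size m) * B"
proof (induction m)
  case (add x m)
  then show ?case using assms[of x] by (auto simp: algebra_simps)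
qed simp

lemma abs_apply_bcontfun_le: "\<bar>apply_bcontfun f x\<bar> \<le> norm (f :: 'a::topological_space \<Rightarrow>\<^sub>C real)"
  using norm_bounded[of f x] by simp

lemma substitution_imp_mset_substitution: "substitution \<tau> \<Longrightarrow> mset_substitution \<tau>"
  by (auto simp: substitution_def intro: word_substitution_imp_mset_substitution)

lemma subst_op_apply:
  fixes \<tau> :: "'a::topological_space \<Rightarrow> 'a multiset"
  assumes "compact (UNIV :: 'a set)" and "substitution \<tau>"
  shows "apply_bcontfun (blinfun_apply (subst_op \<tau>) f) a = (\<Sum>b\<in>#\<tau> a. apply_bcontfun f b)"
proof -
  note \<tau> = substitution_imp_mset_substitution[OF assms(2)]
  define g where "g f a = (\<Sum>b\<in>#\<tau> a. apply_bcontfun f b)" for f :: "'a \<Rightarrow>\<^sub>C real" and a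
  have cont: "g f \<in> bcontfun" for f
  proof -
    have "continuous_on UNIV (g f)"
      unfolding g_def by (rule continuous_on_sum_subst[OF \<tau>]) simp
    then show ?thesis
      using assms(1) by (auto simp: bcontfun_def intro: compact_imp_bounded compact_continuous_image)
  qed
  then have app: "apply_bcontfun (Bcontfun (g f)) = g f" for f by (rule Bcontfun_inverse)
  have "continuous_on UNIV (\<lambda>a. \<Sum>b\<in>#\<tau> a. (1::real))"
    by (rule continuous_on_sum_subst[OF \<tau>]) simp
  then have "compact (range (\<lambda>a. real (size (\<tau> a))))"
    using compact_continuous_image[OF _ assms(1)] by simp
  then have "bounded (range (\<lambda>a. real (size (\<tau> a))))" by (rule compact_imp_bounded)
  then obtain K where K: "real (size (\<tau> a)) \<le> K" for a
    by (auto simp: bounded_iff)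
  have "bounded_linear (\<lambda>f. Bcontfun (g f))"
  proof (rule bounded_linear_intro[where K = K])
    show "norm (Bcontfun (g f)) \<le> norm f * K" for f
    proof (rule norm_bound)
      fix a
      have "\<bar>g f a\<bar> \<le> real (size (\<tau> a)) * norm f"
        unfolding g_def by (rule sum_mset_abs_le[OF abs_apply_bcontfun_le])
      also have "\<dots> \<le> norm f * K"
        using mult_right_mono[OF K[of a] norm_ge_zero[of f]] by (simp add: mult.commute)
      finally show "norm (apply_bcontfun (Bcontfun (g f)) a) \<le> norm f * K" by (simp add: app)
    qed
  qed (auto intro!: bcontfun_eqI simp: app plus_bcontfun.rep_eq scaleR_bcontfun.rep_eq g_def
        sum_mset.distrib sum_mset_distrib_left)
  then have "blinfun_apply (subst_op \<tau>) f = Bcontfun (g f)"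
    using bounded_linear_Blinfun_apply by (fastforce simp: subst_op_def g_def[abs_def])
  then show ?thesis by (simp add: app g_def)
qed

text \<open>\<open>C(A\<^sup>\<infinity>)\<close> for the subspace \<open>A\<^sup>\<infinity>\<close> of accumulation points, which may be empty (the function
  space is then the zero space). A function on \<open>A\<^sup>\<infinity>\<close> is represented by its extension by zero to
  the whole type, which does not affect the sup norm. Boundedness is automatic when \<open>A\<^sup>\<infinity>\<close> is
  compact.\<close>

typedef (overloaded) 'a acc_fun =
    "{f :: 'a::topological_space \<Rightarrow> real.
       continuous_on acc_points f \<and> bounded (range f) \<and> (\<forall>a. a \<notin> acc_points \<longrightarrow> f a = 0)}"
  morphisms apply_acc_fun Acc_fun
  by (rule exI[of _ "\<lambda>_. 0"]) auto

setup_lifting type_definition_acc_fun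

lemma acc_fun_eqI: "(\<And>a. apply_acc_fun f a = apply_acc_fun g a) \<Longrightarrow> f = g"
  by transfer auto

instantiation acc_fun :: (topological_space) real_normed_vector
begin

lift_definition zero_acc_fun :: "'a acc_fun" is "\<lambda>_. 0" by auto

lift_definition plus_acc_fun :: "'a acc_fun \<Rightarrow> 'a acc_fun \<Rightarrow> 'a acc_fun" is "\<lambda>f g a. f a + g a"
  by (auto intro: continuous_intros bounded_plus_comp)

lift_definition minus_acc_fun :: "'a acc_fun \<Rightarrow> 'a acc_fun \<Rightarrow> 'a acc_fun" is "\<lambda>f g a. f a - g a"
  by (auto intro: continuous_intros bounded_minus_comp)

lift_definition uminus_acc_fun :: "'a acc_fun \<Rightarrow> 'a acc_fun" is "\<lambda>f a. - f a"
  by (auto intro: continuous_intros simp: bounded_iff)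

lift_definition scaleR_acc_fun :: "real \<Rightarrow> 'a acc_fun \<Rightarrow> 'a acc_fun" is "\<lambda>r f a. r * f a"
  using bounded_scaleR_comp by (fastforce intro: continuous_intros)

lift_definition norm_acc_fun :: "'a acc_fun \<Rightarrow> real" is "\<lambda>f. SUP a. \<bar>f a\<bar>" .

definition dist_acc_fun :: "'a acc_fun \<Rightarrow> 'a acc_fun \<Rightarrow> real"
  where "dist_acc_fun f g = norm (f - g)"

definition sgn_acc_fun :: "'a acc_fun \<Rightarrow> 'a acc_fun"
  where "sgn_acc_fun f = inverse (norm f) *\<^sub>R f"

definition uniformity_acc_fun :: "('a acc_fun \<times> 'a acc_fun) filter"
  where "uniformity_acc_fun = (INF e\<in>{0<..}. principal {(x, y). dist x y < e})"

definition open_acc_fun :: "'a acc_fun set \<Rightarrow> bool"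
  where "open_acc_fun S = (\<forall>x\<in>S. \<forall>\<^sub>F (x', y) in uniformity. x' = x \<longrightarrow> y \<in> S)"

lemma abs_apply_acc_fun_le: "\<bar>apply_acc_fun f a\<bar> \<le> norm f"
  by transfer (auto simp: bounded_iff intro!: cSUP_upper bdd_aboveI2)

lemma norm_acc_fun_le: "(\<And>a. \<bar>apply_acc_fun f a\<bar> \<le> B) \<Longrightarrow> norm f \<le> B"
  by transfer (auto intro: cSUP_least)

instance
proof
  fix f g h :: "'a acc_fun" and r s :: real
  show "f + g + h = f + (g + h)" "f + g = g + f" "0 + f = f" "- f + f = 0" "f - g = f + - g"
    "r *\<^sub>R (f + g) = r *\<^sub>R f + r *\<^sub>R g" "(r + s) *\<^sub>R f = r *\<^sub>R f + s *\<^sub>R f"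
    "r *\<^sub>R s *\<^sub>R f = (r * s) *\<^sub>R f" "1 *\<^sub>R f = f"
    by (transfer; auto simp: algebra_simps)+
  show "dist f g = norm (f - g)" by (rule dist_acc_fun_def)
  show "sgn f = inverse (norm f) *\<^sub>R f" by (rule sgn_acc_fun_def)
  show "norm (f + g) \<le> norm f + norm g"
  proof (rule norm_acc_fun_le)
    fix a
    show "\<bar>apply_acc_fun (f + g) a\<bar> \<le> norm f + norm g"
      using abs_apply_acc_fun_le[of f a] abs_apply_acc_fun_le[of g a]
      by (simp add: plus_acc_fun.rep_eq)
  qed
  show "norm f = 0 \<longleftrightarrow> f = 0"
  proof
    assume "norm f = 0"
    then have "apply_acc_fun f a = 0" for a using abs_apply_acc_fun_le[of f a] by simp
    then show "f = 0" by (intro acc_fun_eqI) (simp add: zero_acc_fun.rep_eq)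
  qed (simp add: norm_acc_fun.rep_eq zero_acc_fun.rep_eq)
  show "norm (r *\<^sub>R f) = \<bar>r\<bar> * norm f"
  proof (rule antisym)
    show le: "norm (r *\<^sub>R f) \<le> \<bar>r\<bar> * norm f" for r and f :: "'a acc_fun"
      by (rule norm_acc_fun_le)
        (simp add: scaleR_acc_fun.rep_eq abs_mult mult_left_mono abs_apply_acc_fun_le)
    show "\<bar>r\<bar> * norm f \<le> norm (r *\<^sub>R f)"
    proof (cases "r = 0")
      case False
      have "f = inverse r *\<^sub>R (r *\<^sub>R f)"
        using False by (intro acc_fun_eqI) (simp add: scaleR_acc_fun.rep_eq)
      then have "norm f \<le> \<bar>inverse r\<bar> * norm (r *\<^sub>R f)" using le by metis
      then show ?thesis using False by (simp add: field_simps)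
    next
      case True
      have "\<bar>apply_acc_fun (r *\<^sub>R f) undefined\<bar> \<le> norm (r *\<^sub>R f)" by (rule abs_apply_acc_fun_le)
      with True show ?thesis by simp
    qed
  qed
qed (rule uniformity_acc_fun_def open_acc_fun_def)+

end

definition acc_subst_op ::
    "('a::topological_space \<Rightarrow> 'a multiset) \<Rightarrow> 'a acc_fun \<Rightarrow>\<^sub>L 'a acc_fun" where
  "acc_subst_op \<tau> = Blinfun (\<lambda>f. Acc_fun (\<lambda>a. \<Sum>b\<in>#acc_subst \<tau> a. apply_acc_fun f b))"

lemma acc_subst_op_apply:
  fixes \<tau> :: "'a::t2_space \<Rightarrow> 'a multiset"
  assumes fin: "finite (acc_points :: 'a set)"
  shows "apply_acc_fun (blinfun_apply (acc_subst_op \<tau>) f) a =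
    (\<Sum>b\<in>#acc_subst \<tau> a. apply_acc_fun f b)"
proof -
  define g where "g f a = (\<Sum>b\<in>#acc_subst \<tau> a. apply_acc_fun f b)" for f a
  define K where "K = real (\<Sum>a\<in>acc_points. size (\<tau> a))"
  have K: "real (size (acc_subst \<tau> a)) \<le> K" for a
    using member_le_sum[of a acc_points "\<lambda>a. size (\<tau> a)"] fin
    by (auto simp: acc_subst_def K_def intro: sum_nonneg simp flip: of_nat_sum)
  have bnd: "\<bar>g f a\<bar> \<le> norm f * K" for f a
  proof -
    have "\<bar>g f a\<bar> \<le> real (size (acc_subst \<tau> a)) * norm f"
      unfolding g_def by (rule sum_mset_abs_le[OF abs_apply_acc_fun_le])
    also have "\<dots> \<le> norm f * K"
      using mult_right_mono[OF K[of a] norm_ge_zero[of f]] by (simp add: mult.commute)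
    finally show ?thesis .
  qed
  have app: "apply_acc_fun (Acc_fun (g f)) = g f" for f
  proof (rule Acc_fun_inverse)
    have "bounded (range (g f))" using bnd[of f] by (auto simp: bounded_iff)
    then show "g f \<in> {f. continuous_on acc_points f \<and> bounded (range f) \<and>
        (\<forall>a. a \<notin> acc_points \<longrightarrow> f a = 0)}"
      using fin by (auto simp: continuous_on_finite g_def acc_subst_def)
  qed
  have "bounded_linear (\<lambda>f. Acc_fun (g f))"
  proof (rule bounded_linear_intro[where K = K])
    show "norm (Acc_fun (g f)) \<le> norm f * K" for f
      by (rule norm_acc_fun_le) (simp add: app bnd)
  qed (rule acc_fun_eqI, simp add: app plus_acc_fun.rep_eq scaleR_acc_fun.rep_eq,
      simp add: g_def plus_acc_fun.rep_eq scaleR_acc_fun.rep_eq sum_mset.distrib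
        sum_mset_distrib_left)+
  then have "blinfun_apply (acc_subst_op \<tau>) f = Acc_fun (g f)"
    using bounded_linear_Blinfun_apply by (fastforce simp: acc_subst_op_def g_def[abs_def])
  then show ?thesis by (simp add: app g_def)
qed


section \<open>Essential norm and spectral radii\<close>

definition op_pow :: "'e::real_normed_vector \<Rightarrow>\<^sub>L 'e \<Rightarrow> nat \<Rightarrow> 'e \<Rightarrow>\<^sub>L 'e" where
  "op_pow T n = ((o\<^sub>L) T ^^ n) id_blinfun"

definition compact_op :: "'e::real_normed_vector \<Rightarrow>\<^sub>L 'e \<Rightarrow> bool" where
  "compact_op V \<longleftrightarrow> compact (closure (blinfun_apply V ` cball 0 1))"

definition ess_norm :: "'e::real_normed_vector \<Rightarrow>\<^sub>L 'e \<Rightarrow> real" where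
  "ess_norm T = (INF V\<in>{V. compact_op V}. norm (T - V))"

definition ess_radius :: "'e::real_normed_vector \<Rightarrow>\<^sub>L 'e \<Rightarrow> real" where
  "ess_radius T = lim (\<lambda>n. root n (ess_norm (op_pow T n)))"

text \<open>The spectrum of an operator on a real space is that of its complexification. The map below is
  \<open>z - T\<close> on the complexification, whose elements \<open>x + i y\<close> are represented as pairs \<open>(x, y)\<close>;
  an inverse of it is automatically complex linear.\<close>

definition complex_shift :: "complex \<Rightarrow> 'e::real_normed_vector \<Rightarrow>\<^sub>L 'e \<Rightarrow> 'e \<times> 'e \<Rightarrow> 'e \<times> 'e" where
  "complex_shift z T = (\<lambda>(x, y).
     (Re z *\<^sub>R x - Im z *\<^sub>R y - blinfun_apply T x, Im z *\<^sub>R x + Re z *\<^sub>R y - blinfun_apply T y))"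

definition op_spectrum :: "'e::real_normed_vector \<Rightarrow>\<^sub>L 'e \<Rightarrow> complex set" where
  "op_spectrum T = {z. \<not> (\<exists>S. bounded_linear S \<and> S \<circ> complex_shift z T = id \<and> complex_shift z T \<circ> S = id)}"

text \<open>The element 0 only matters on the zero space, where the spectrum is empty.\<close>

definition op_spectral_radius :: "'e::real_normed_vector \<Rightarrow>\<^sub>L 'e \<Rightarrow> real" where
  "op_spectral_radius T = Sup (insert 0 (cmod ` op_spectrum T))"

end

theory Submission
  imports Defs "Jordan_Normal_Form.Spectral_Radius"
begin

text \<open>Since an isolated letter occurs a locally constant number of times in \<open>\<tau> a\<close>, condition (3) forces
  \<open>\<tau> p\<close> to consist of accumulation points when \<open>p\<close> is one, and condition (4) propagates to the
  iterates: \<open>#\<tau>\<^sup>n(a) \<le> #\<tau>\<^sup>n(p)\<close> for \<open>a\<close> in the neighbourhood of \<open>p\<close>. So both \<open>M\<^sup>n\<close> and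
  \<open>M\<^sub>\<infinity>\<^sup>n\<close> attain their norm on the constant function 1. By Fekete's lemma the \<open>n\<close>-th roots of these
  norms have a limit \<open>\<rho>\<close>; Neumann series bound both spectra by \<open>\<rho>\<close>, and a dominant eigenvalue \<open>z\<close>
  of the matrix of letter counts has \<open>\<rho> \<le> |z|\<close>. Its left eigenvector gives a functional,
  supported on the accumulation points, that annihilates the ranges of both \<open>z - M\<close> and
  \<open>z - M\<^sub>\<infinity>\<close>, so \<open>z\<close> lies in both spectra.

  For the lower bound on the essential norm, there are points near a maximizing \<open>p\<close> whose images
  under \<open>\<tau>\<^sup>n\<close> have maximal length and pairwise disjoint finite sets of isolated letters. A compact
  operator is almost constant on some two of the indicators of these sets, and \<open>M\<^sup>n\<close> has maximal
  effect on their difference.\<close>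

section \<open>Iterates of substitutions\<close>

lemma sum_mset_sum_mset: "(\<Sum>c\<in>#(\<Sum>b\<in>#m. g b). f c) = (\<Sum>b\<in>#m. \<Sum>c\<in>#g b. f c)"
  by (induction m) auto

lemma size_sum_mset:
  fixes g :: "'a \<Rightarrow> 'b multiset"
  shows "size (\<Sum>b\<in>#m. g b) = (\<Sum>b\<in>#m. size (g b))"
  by (induction m) auto

lemma count_sum_mset: "count (\<Sum>b\<in>#m. g b) x = (\<Sum>b\<in>#m. count (g b) x)"
  by (induction m) auto

text \<open>Once the letters of a word are known to be accumulation points, this turns sums over
  letters into products with the finite matrix of letter counts.\<close>

lemma sum_mset_eq_sum_count:
  fixes f :: "'a \<Rightarrow> 'b::comm_semiring_1"
  assumes "finite S" "set_mset m \<subseteq> S"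
  shows "(\<Sum>b\<in>#m. f b) = (\<Sum>b\<in>S. of_nat (count m b) * f b)"
  using assms(2)
proof (induction m)
  case (add x m)
  have "(\<Sum>b\<in>S. of_nat (count (add_mset x m) b) * f b)
      = (\<Sum>b\<in>S. (if b = x then f b else 0) + of_nat (count m b) * f b)"
    by (intro sum.cong) (auto simp: algebra_simps)
  also have "\<dots> = f x + (\<Sum>b\<in>S. of_nat (count m b) * f b)"
    using add.prems assms(1) by (simp add: sum.distrib)
  finally show ?case using add by simp
qed simp

text \<open>The iterated extension is additive, hence determined by its values on single
  letters.\<close>

lemma funpow_subst_ext: "(subst_ext \<tau> ^^ n) m = (\<Sum>b\<in>#m. subst_iter \<tau> n b)"
proof -
  have "(subst_ext \<tau> ^^ n) {#} = {#}"
    by (induction n) (auto simp: subst_ext_def)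
  moreover have "(subst_ext \<tau> ^^ n) (k + l) = (subst_ext \<tau> ^^ n) k + (subst_ext \<tau> ^^ n) l" for k l
    by (induction n) (auto simp: subst_ext_def)
  ultimately show ?thesis
    unfolding subst_iter_def by (induction m) (auto simp del: funpow.simps, metis add_mset_add_single union_commute)
qed

lemma subst_iter_0 [simp]: "subst_iter \<tau> 0 a = {#a#}"
  by (simp add: subst_iter_def)

lemma subst_iter_Suc: "subst_iter \<tau> (Suc n) a = (\<Sum>b\<in>#\<tau> a. subst_iter \<tau> n b)"
proof -
  have "subst_iter \<tau> (Suc n) a = (subst_ext \<tau> ^^ n) (\<tau> a)"
    by (simp add: subst_iter_def funpow_swap1 subst_ext_def)
  then show ?thesis by (simp only: funpow_subst_ext)
qed

text \<open>Peels off the last application of \<tau> instead of the first. On counts this is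
  multiplication on the right by the count matrix, the recursion that
  \<open>dominant_left_eigenvector\<close> expects.\<close>

lemma subst_iter_Suc_left: "subst_iter \<tau> (Suc n) a = (\<Sum>b\<in>#subst_iter \<tau> n a. \<tau> b)"
  by (simp add: subst_iter_def subst_ext_def)

section \<open>Powers of operators and iterates of substitutions\<close>

lemma op_pow_0 [simp]: "op_pow T 0 = id_blinfun"
  by (simp add: op_pow_def)

lemma op_pow_Suc: "op_pow T (Suc n) = T o\<^sub>L op_pow T n"
  by (simp add: op_pow_def)

lemma op_pow_add: "op_pow T (m + n) = op_pow T m o\<^sub>L op_pow T n"
  by (induction m) (auto simp: op_pow_Suc intro!: blinfun_eqI)

lemma op_pow_Suc_apply: "op_pow T (Suc n) x = op_pow T n (T x)"
  using op_pow_add[of T n 1] by (simp add: op_pow_Suc)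

lemma op_pow_subst_op:
  fixes \<tau> :: "'a::topological_space \<Rightarrow> 'a multiset"
  assumes "compact (UNIV :: 'a set)" "substitution \<tau>"
  shows "apply_bcontfun (op_pow (subst_op \<tau>) n f) a = (\<Sum>b\<in>#subst_iter \<tau> n a. apply_bcontfun f b)"
  by (induction n arbitrary: a)
    (auto simp: op_pow_Suc subst_op_apply[OF assms] subst_iter_Suc sum_mset_sum_mset)

lemma op_pow_acc_subst_op:
  fixes \<tau> :: "'a::t2_space \<Rightarrow> 'a multiset"
  assumes "finite (acc_points :: 'a set)"
  shows "apply_acc_fun (op_pow (acc_subst_op \<tau>) n f) a =
    (\<Sum>b\<in>#subst_iter (acc_subst \<tau>) n a. apply_acc_fun f b)"
  by (induction n arbitrary: a)
    (auto simp: op_pow_Suc acc_subst_op_apply[OF assms] subst_iter_Suc sum_mset_sum_mset)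

section \<open>Fekete's lemma\<close>

lemma submultiplicative_power_le:
  fixes u :: "nat \<Rightarrow> real"
  assumes nonneg: "\<And>n. 0 \<le> u n" and submult: "\<And>m n. u (m + n) \<le> u m * u n"
  shows "u (q * m + r) \<le> u m ^ q * u r"
proof (induction q)
  case (Suc q)
  have "u (Suc q * m + r) \<le> u m * u (q * m + r)"
    using submult[of m "q * m + r"] by (simp add: add.assoc)
  also have "\<dots> \<le> u m * (u m ^ q * u r)"
    by (intro mult_left_mono Suc nonneg)
  finally show ?case by (simp add: mult.assoc)
qed simp

text \<open>Division with remainder by an \<open>m\<close> with nearly minimal root gives u n \<le>
  K * c^n, where c exceeds the infimum by e/2 and the n-th root of K tends to 1. The infimum starts
  at 1 because \<open>root 0\<close> is constantly 0. The lemma is applied to norms and to essential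
  norms.\<close>

lemma root_submultiplicative_convergent:
  fixes u :: "nat \<Rightarrow> real"
  assumes nonneg: "\<And>n. 0 \<le> u n" and submult: "\<And>m n. u (m + n) \<le> u m * u n"
  shows "(\<lambda>n. root n (u n)) \<longlonglongrightarrow> (INF n\<in>{1..}. root n (u n))"
proof (rule LIMSEQ_I)
  fix e :: real assume "0 < e"
  define L where "L = (INF n\<in>{1..}. root n (u n))"
  have bdd: "bdd_below ((\<lambda>n. root n (u n)) ` {1..})"
    by (rule bdd_belowI[of _ 0]) (auto simp: nonneg)
  have L_le: "L \<le> root n (u n)" if "n \<ge> 1" for n
    unfolding L_def using bdd that by (intro cINF_lower) auto
  have "0 \<le> L"
    unfolding L_def by (intro cINF_greatest) (auto simp: nonneg)
  have "\<exists>m\<in>{1..}. root m (u m) < L + e / 2"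
    using \<open>0 < e\<close> bdd unfolding L_def by (subst cINF_less_iff[symmetric]) auto
  then obtain m where m: "m \<ge> 1" "root m (u m) < L + e / 2"
    by auto
  define c where "c = L + e / 2"
  have "c > 0" using \<open>0 \<le> L\<close> \<open>0 < e\<close> by (simp add: c_def)
  have um: "u m \<le> c ^ m"
  proof -
    have "u m = root m (u m) ^ m" using m nonneg by simp
    also have "\<dots> \<le> c ^ m" using m by (intro power_mono) (auto simp: c_def nonneg)
    finally show ?thesis .
  qed
  \<comment> \<open>The sum bounds the contribution of every possible remainder modulo
    \<open>m\<close>; the summand 1 keeps \<open>K\<close> positive even if \<open>u\<close>
    vanishes.\<close>
  define K where "K = 1 + (\<Sum>r<m. u r / c ^ r)"
  have "K \<ge> 1" unfolding K_def using \<open>c > 0\<close> by (auto intro!: sum_nonneg simp: nonneg)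
  have un: "u n \<le> K * c ^ n" for n
  proof -
    have r: "n mod m < m" using m by simp
    have "u n \<le> u m ^ (n div m) * u (n mod m)"
      using submultiplicative_power_le[of u "n div m" m "n mod m", OF nonneg submult] by simp
    also have "\<dots> \<le> (c ^ m) ^ (n div m) * u (n mod m)"
      by (intro mult_right_mono power_mono um nonneg)
    also have "\<dots> = c ^ n * (u (n mod m) / c ^ (n mod m))"
    proof -
      have "c ^ n = c ^ (m * (n div m)) * c ^ (n mod m)"
        by (simp flip: power_add)
      then show ?thesis using \<open>c > 0\<close> by (simp add: power_mult)
    qed
    also have "\<dots> \<le> c ^ n * K"
    proof (rule mult_left_mono)
      have "u (n mod m) / c ^ (n mod m) \<le> (\<Sum>r<m. u r / c ^ r)"
        using r \<open>c > 0\<close> by (intro member_le_sum) (auto simp: nonneg)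
      then show "u (n mod m) / c ^ (n mod m) \<le> K" by (simp add: K_def)
    qed (use \<open>c > 0\<close> in simp)
    finally show ?thesis by (simp add: mult.commute)
  qed
  have "(\<lambda>n. root n K * c) \<longlonglongrightarrow> 1 * c"
    using \<open>K \<ge> 1\<close> by (intro tendsto_intros LIMSEQ_root_const) auto
  then have "eventually (\<lambda>n. root n K * c < L + e) sequentially"
    using \<open>0 < e\<close> by (intro order_tendstoD) (auto simp: c_def)
  then have "eventually (\<lambda>n. norm (root n (u n) - L) < e) sequentially"
    using eventually_ge_at_top[of 1]
  proof eventually_elim
    case (elim n)
    have "root n (u n) \<le> root n (K * c ^ n)" using un[of n] elim by simp
    also have "\<dots> = root n K * c" using elim \<open>c > 0\<close> by (simp add: real_root_mult real_root_power_cancel)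
    finally show ?case using L_le[of n] elim by simp
  qed
  then show "\<exists>n0. \<forall>n\<ge>n0. norm (root n (u n) - L) < e"
    by (simp add: eventually_sequentially)
qed

section \<open>The essential norm\<close>

text \<open>A closed subset of a compact set is compact, so any compact superset of the image of the
  unit ball will do. Sums and compositions then need no closures.\<close>

lemma compact_op_iff:
  "compact_op V \<longleftrightarrow> (\<exists>K. compact K \<and> blinfun_apply V ` cball 0 1 \<subseteq> K)"
proof
  assume "\<exists>K. compact K \<and> blinfun_apply V ` cball 0 1 \<subseteq> K"
  then obtain K where "compact K" "blinfun_apply V ` cball 0 1 \<subseteq> K" by blast
  then show "compact_op V"
    unfolding compact_op_def
    by (metis closed_closure closure_minimal compact_Int_closed compact_imp_closed inf.absorb_iff2)
qed (auto simp: compact_op_def intro: closure_subset[THEN subsetD])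

lemma compact_op_zero: "compact_op 0"
  unfolding compact_op_iff by (rule exI[of _ "{0}"]) auto

lemma compact_op_plus:
  assumes "compact_op V" "compact_op W"
  shows "compact_op (V + W)"
proof -
  obtain K L where "compact K" "blinfun_apply V ` cball 0 1 \<subseteq> K"
    "compact L" "blinfun_apply W ` cball 0 1 \<subseteq> L"
    using assms unfolding compact_op_iff by blast
  then have "compact {x + y | x y. x \<in> K \<and> y \<in> L}"
    "blinfun_apply (V + W) ` cball 0 1 \<subseteq> {x + y | x y. x \<in> K \<and> y \<in> L}"
    using compact_sums by (blast, force simp: blinfun.add_left)
  then show ?thesis
    unfolding compact_op_iff by blast
qed

lemma compact_op_compose_left:
  assumes "compact_op V"
  shows "compact_op (A o\<^sub>L V)"
proof -
  obtain K where "compact K" "blinfun_apply V ` cball 0 1 \<subseteq> K"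
    using assms unfolding compact_op_iff by blast
  then show ?thesis
    unfolding compact_op_iff
    by (intro exI[of _ "blinfun_apply A ` K"] conjI compact_continuous_image)
      (auto intro: continuous_intros)
qed

lemma compact_op_compose_right:
  assumes "compact_op V"
  shows "compact_op (V o\<^sub>L A)"
proof -
  obtain K where K: "compact K" "blinfun_apply V ` cball 0 1 \<subseteq> K"
    using assms unfolding compact_op_iff by blast
  \<comment> \<open>Dividing by \<open>r\<close> brings the image of the unit ball under
    \<open>A\<close> back into the unit ball; the 1 keeps \<open>r\<close> positive when
    \<open>A\<close> is zero.\<close>
  define r where "r = norm A + 1"
  have "r > 0" unfolding r_def using norm_ge_zero[of A] by linarith
  have "V (A x) \<in> (*\<^sub>R) r ` K" if "norm x \<le> 1" for x
  proof
    have "norm (A x) \<le> norm A * norm x" by (rule norm_blinfun)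
    also have "\<dots> \<le> r"
      using that mult_left_le[of "norm x" "norm A"] by (simp add: r_def)
    finally have "(1 / r) *\<^sub>R A x \<in> cball 0 1"
      using \<open>r > 0\<close> by simp
    then show "V ((1 / r) *\<^sub>R A x) \<in> K" using K(2) by blast
    show "V (A x) = r *\<^sub>R V ((1 / r) *\<^sub>R A x)"
      using \<open>r > 0\<close> by (simp add: blinfun.scaleR_right)
  qed
  then show ?thesis
    unfolding compact_op_iff
    by (intro exI[of _ "(*\<^sub>R) r ` K"] conjI compact_scaling K(1)) auto
qed

lemma bdd_below_norm_diff: "bdd_below ((\<lambda>V. norm (T - V)) ` S)"
  by (rule bdd_belowI[of _ 0]) auto

lemma ess_norm_le: "compact_op V \<Longrightarrow> ess_norm T \<le> norm (T - V)"
  unfolding ess_norm_def using bdd_below_norm_diff by (rule cINF_lower) simp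

lemma ess_norm_greatest: "(\<And>V. compact_op V \<Longrightarrow> c \<le> norm (T - V)) \<Longrightarrow> c \<le> ess_norm T"
  unfolding ess_norm_def using compact_op_zero by (intro cINF_greatest) auto

lemma ess_norm_le_norm: "ess_norm T \<le> norm T"
  using ess_norm_le[OF compact_op_zero] by simp

lemma ess_norm_nonneg: "0 \<le> ess_norm T"
  by (rule ess_norm_greatest) simp

lemma ess_norm_less_witness:
  assumes "ess_norm T < c"
  obtains V where "compact_op V" "norm (T - V) < c"
  using assms ess_norm_greatest[of c T] by force

text \<open>If V and W are compact, then (A - V)(B - W) differs from AB by the compact operator AW +
  V(B - W). Nearly optimal V and W give the bound up to \<epsilon>, which then tends to 0. This is
  the submultiplicativity that makes the essential spectral radius a genuine limit.\<close>

lemma ess_norm_compose: "ess_norm (A o\<^sub>L B) \<le> ess_norm A * ess_norm B"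
proof -
  define \<epsilon> where "\<epsilon> k = inverse (real (Suc k))" for k
  have \<epsilon>: "\<epsilon> k > 0" for k by (simp add: \<epsilon>_def)
  have "ess_norm (A o\<^sub>L B) \<le> (ess_norm A + \<epsilon> k) * (ess_norm B + \<epsilon> k)" for k
  proof -
    obtain V where V: "compact_op V" "norm (A - V) < ess_norm A + \<epsilon> k"
      using ess_norm_less_witness[of A "ess_norm A + \<epsilon> k"] \<epsilon>[of k] by auto
    obtain W where W: "compact_op W" "norm (B - W) < ess_norm B + \<epsilon> k"
      using ess_norm_less_witness[of B "ess_norm B + \<epsilon> k"] \<epsilon>[of k] by auto
    have "compact_op ((A o\<^sub>L W) + (V o\<^sub>L (B - W)))"
      by (intro compact_op_plus compact_op_compose_left compact_op_compose_right V W)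
    then have "ess_norm (A o\<^sub>L B) \<le> norm ((A o\<^sub>L B) - ((A o\<^sub>L W) + (V o\<^sub>L (B - W))))"
      by (rule ess_norm_le)
    also have "(A o\<^sub>L B) - ((A o\<^sub>L W) + (V o\<^sub>L (B - W))) = (A - V) o\<^sub>L (B - W)"
      by (rule blinfun_eqI) (simp add: blinfun.diff_left blinfun.diff_right blinfun.add_left)
    also have "norm \<dots> \<le> norm (A - V) * norm (B - W)"
      by (rule norm_blinfun_compose)
    also have "\<dots> \<le> (ess_norm A + \<epsilon> k) * (ess_norm B + \<epsilon> k)"
      using V W \<epsilon>[of k] by (intro mult_mono) (auto intro: add_nonneg_nonneg ess_norm_nonneg less_imp_le)
    finally show ?thesis .
  qed
  moreover have "(\<lambda>k. (ess_norm A + \<epsilon> k) * (ess_norm B + \<epsilon> k)) \<longlonglongrightarrow> (ess_norm A + 0) * (ess_norm B + 0)"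
    unfolding \<epsilon>_def by (intro tendsto_intros LIMSEQ_inverse_real_of_nat)
  ultimately show ?thesis
    using LIMSEQ_le_const[of _ _ "ess_norm (A o\<^sub>L B)"] by fastforce
qed

section \<open>Neumann series\<close>

text \<open>Completeness is an explicit hypothesis on Cauchy sequences, since \<open>acc_fun\<close>
  is introduced only as a \<open>real_normed_vector\<close>.\<close>

lemma summable_of_summable_norm:
  fixes u :: "nat \<Rightarrow> 'e::real_normed_vector"
  assumes complete: "\<And>X :: nat \<Rightarrow> 'e. Cauchy X \<Longrightarrow> convergent X"
    and "summable (\<lambda>n. norm (u n))"
  shows "summable u"
proof -
  have "Cauchy (\<lambda>n. \<Sum>i<n. u i)"
  proof (rule metric_CauchyI)
    fix e :: real assume "0 < e"
    then obtain N where N: "\<And>m n. m \<ge> N \<Longrightarrow> norm (sum (\<lambda>n. norm (u n)) {m..<n}) < e"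
      using assms(2) unfolding summable_Cauchy by blast
    have *: "dist (\<Sum>i<m. u i) (\<Sum>i<n. u i) < e" if "N \<le> m" "m \<le> n" for m n
    proof -
      have "(\<Sum>i<n. u i) - (\<Sum>i<m. u i) = sum u {m..<n}"
        using that by (simp add: sum_diff_nat_ivl lessThan_atLeast0)
      then have "dist (\<Sum>i<m. u i) (\<Sum>i<n. u i) = norm (sum u {m..<n})"
        by (metis dist_commute dist_norm)
      also have "\<dots> \<le> sum (\<lambda>n. norm (u n)) {m..<n}" by (rule norm_sum)
      also have "\<dots> < e" using N[OF that(1), of n] by simp
      finally show ?thesis .
    qed
    show "\<exists>M. \<forall>m\<ge>M. \<forall>n\<ge>M. dist (\<Sum>i<m. u i) (\<Sum>i<n. u i) < e"
      by (metis * dist_commute nle_le)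
  qed
  then show ?thesis
    using complete by (simp add: summable_iff_convergent)
qed

lemma norm_suminf_le_suminf:
  assumes "summable u" "\<And>n. norm (u n) \<le> b n" "summable b"
  shows "norm (suminf u :: 'e::real_normed_vector) \<le> suminf b"
proof (rule LIMSEQ_le)
  show "(\<lambda>n. norm (\<Sum>i<n. u i)) \<longlonglongrightarrow> norm (suminf u)"
    by (intro tendsto_norm summable_LIMSEQ assms)
  show "(\<lambda>n. \<Sum>i<n. b i) \<longlonglongrightarrow> suminf b"
    by (intro summable_LIMSEQ assms)
  show "\<exists>N. \<forall>n\<ge>N. norm (\<Sum>i<n. u i) \<le> (\<Sum>i<n. b i)"
    using assms by (auto intro: sum_norm_le)
qed

lemma Cauchy_prod_convergent:
  fixes X :: "nat \<Rightarrow> 'e::real_normed_vector \<times> 'e"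
  assumes complete: "\<And>X :: nat \<Rightarrow> 'e. Cauchy X \<Longrightarrow> convergent X" and "Cauchy X"
  shows "convergent X"
proof -
  have "convergent (\<lambda>n. fst (X n))" "convergent (\<lambda>n. snd (X n))"
    using assms by (auto intro: Cauchy_fst Cauchy_snd)
  then obtain a b where "(\<lambda>n. fst (X n)) \<longlonglongrightarrow> a" "(\<lambda>n. snd (X n)) \<longlonglongrightarrow> b"
    by (auto simp: convergent_def)
  then have "X \<longlonglongrightarrow> (a, b)"
    using tendsto_Pair[of "\<lambda>n. fst (X n)" a sequentially "\<lambda>n. snd (X n)" b] by simp
  then show ?thesis by (rule convergentI)
qed

text \<open>Scalar multiplication of the complexification, in the encoding \<open>x + i y = (x, y)\<close>.\<close>

definition cscale :: "complex \<Rightarrow> 'e::real_vector \<times> 'e \<Rightarrow> 'e \<times> 'e" where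
  "cscale z p = (Re z *\<^sub>R fst p - Im z *\<^sub>R snd p, Im z *\<^sub>R fst p + Re z *\<^sub>R snd p)"

lemma cscale_one [simp]: "cscale 1 p = p"
  by (simp add: cscale_def)

lemma cscale_cscale: "cscale z (cscale w p) = cscale (z * w) p"
  by (simp add: cscale_def prod_eq_iff algebra_simps)

text \<open>The pair norm is not a complex norm, but a crude constant suffices: only boundedness and
  summability depend on it.\<close>

lemma norm_cscale_le: "norm (cscale z p) \<le> 4 * cmod z * norm (p :: 'e::real_normed_vector \<times> 'e)"
proof -
  have "norm (cscale z p) \<le> norm (Re z *\<^sub>R fst p - Im z *\<^sub>R snd p) + norm (Im z *\<^sub>R fst p + Re z *\<^sub>R snd p)"
    unfolding cscale_def by (rule norm_Pair_le)
  also have "\<dots> \<le> (\<bar>Re z\<bar> * norm (fst p) + \<bar>Im z\<bar> * norm (snd p)) + (\<bar>Im z\<bar> * norm (fst p) + \<bar>Re z\<bar> * norm (snd p))"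
    by (intro add_mono order_trans[OF norm_triangle_ineq4] order_trans[OF norm_triangle_ineq]) auto
  also have "\<dots> \<le> (cmod z * norm p + cmod z * norm p) + (cmod z * norm p + cmod z * norm p)"
    by (intro add_mono mult_mono abs_Re_le_cmod abs_Im_le_cmod)
      (auto simp: norm_fst_le[of "fst p" "snd p", simplified] norm_snd_le[of "snd p" "fst p", simplified])
  finally show ?thesis by simp
qed

text \<open>The complex linear extension of \<open>T\<close> to the complexification.\<close>

definition diag_op :: "('e::real_normed_vector \<Rightarrow>\<^sub>L 'e) \<Rightarrow> 'e \<times> 'e \<Rightarrow> 'e \<times> 'e" where
  "diag_op T p = (T (fst p), T (snd p))"

lemma diag_op_cscale: "diag_op T (cscale z p) = cscale z (diag_op T p)"
  by (simp add: diag_op_def cscale_def blinfun.diff_right blinfun.add_right blinfun.scaleR_right)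

text \<open>The first form shows that the Neumann series is a right inverse of z - T, the second
  that it is a left inverse.\<close>

lemma diag_op_pow_Suc:
  "diag_op (op_pow T (Suc n)) p = diag_op T (diag_op (op_pow T n) p)"
  "diag_op (op_pow T (Suc n)) p = diag_op (op_pow T n) (diag_op T p)"
  by (simp add: diag_op_def op_pow_Suc) (simp add: diag_op_def op_pow_Suc_apply)

lemma norm_diag_op_le: "norm (diag_op T p) \<le> 2 * norm T * norm p"
proof -
  have "norm (diag_op T p) \<le> norm (T (fst p)) + norm (T (snd p))"
    unfolding diag_op_def by (rule norm_Pair_le)
  also have "\<dots> \<le> norm T * norm p + norm T * norm p"
    by (intro add_mono order_trans[OF norm_blinfun] mult_left_mono)
      (auto simp: norm_fst_le[of "fst p" "snd p", simplified] norm_snd_le[of "snd p" "fst p", simplified])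
  finally show ?thesis by (simp add: mult_ac)
qed

lemma bounded_linear_cscale: "bounded_linear (cscale z :: 'e::real_normed_vector \<times> 'e \<Rightarrow> _)"
  by (rule bounded_linear_intro[where K = "4 * cmod z"])
    (use norm_cscale_le in \<open>auto simp: cscale_def prod_eq_iff algebra_simps\<close>)

lemma bounded_linear_diag_op: "bounded_linear (diag_op T)"
  by (rule bounded_linear_intro[where K = "2 * norm T"])
    (use norm_diag_op_le in \<open>auto simp: diag_op_def prod_eq_iff blinfun.add_right
      blinfun.scaleR_right mult_ac\<close>)

lemma complex_shift_eq: "complex_shift z T p = cscale z p - diag_op T p"
  by (simp add: complex_shift_def cscale_def diag_op_def case_prod_beta)

text \<open>The Neumann series, the sum of T^n / z^(n+1), converges absolutely to a bounded
  operator, and applying z - T on either side makes it telescope to the identity.\<close>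

lemma not_in_op_spectrum:
  fixes T :: "'e::real_normed_vector \<Rightarrow>\<^sub>L 'e"
  assumes complete: "\<And>X :: nat \<Rightarrow> 'e. Cauchy X \<Longrightarrow> convergent X"
    and z: "z \<noteq> 0" and summ: "summable (\<lambda>n. norm (op_pow T n) / cmod z ^ n)"
  shows "z \<notin> op_spectrum T"
proof -
  define w where "w = inverse z"
  have zw: "z * w = 1" "w * (z * k) = k" for k using z by (simp_all add: w_def)
  \<comment> \<open>\<open>v\<close> is the sequence to be telescoped and \<open>u = v / z\<close>
    the terms of the series, so that z u(n) - T u(n) = v(n) - v(n+1).\<close>
  define v where "v p n = cscale (w ^ n) (diag_op (op_pow T n) p)" for p n
  define u where "u p n = cscale w (v p n)" for p n
  \<comment> \<open>The factor 32 is 4 * 2 * 4: one \<open>cscale\<close> and one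
    \<open>diag_op\<close> from \<open>v\<close>, another \<open>cscale\<close> from
    \<open>u\<close>.\<close>
  define b where "b n = 32 * cmod w * (norm (op_pow T n) / cmod z ^ n)" for n
  have summ_b: "summable b" unfolding b_def by (intro summable_mult summ)
  have norm_v: "norm (v p n) \<le> 8 * (norm (op_pow T n) / cmod z ^ n) * norm p" for p n
  proof -
    have "norm (v p n) \<le> 4 * cmod (w ^ n) * norm (diag_op (op_pow T n) p)"
      unfolding v_def by (rule norm_cscale_le)
    also have "\<dots> \<le> 4 * cmod (w ^ n) * (2 * norm (op_pow T n) * norm p)"
      by (intro mult_left_mono norm_diag_op_le) auto
    finally show ?thesis
      by (simp add: w_def norm_power norm_inverse divide_inverse power_inverse mult_ac)
  qed
  have norm_u: "norm (u p n) \<le> b n * norm p" for p n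
  proof -
    have "norm (u p n) \<le> 4 * cmod w * norm (v p n)"
      unfolding u_def by (rule norm_cscale_le)
    also have "\<dots> \<le> 4 * cmod w * (8 * (norm (op_pow T n) / cmod z ^ n) * norm p)"
      by (intro mult_left_mono norm_v) auto
    finally show ?thesis by (simp add: b_def mult_ac)
  qed
  have summ_u: "summable (u p)" for p
  proof (rule summable_of_summable_norm)
    show "summable (\<lambda>n. norm (u p n))"
      using norm_u by (intro summable_comparison_test'[OF summable_mult2[OF summ_b, of "norm p"]]) auto
  qed (rule Cauchy_prod_convergent[OF complete])
  have v_lim: "v p \<longlonglongrightarrow> 0" for p
  proof (rule Lim_null_comparison)
    show "\<forall>\<^sub>F n in sequentially. norm (v p n) \<le> 8 * (norm (op_pow T n) / cmod z ^ n) * norm p"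
      using norm_v by simp
    show "(\<lambda>n. 8 * (norm (op_pow T n) / cmod z ^ n) * norm p) \<longlonglongrightarrow> 0"
      by (intro tendsto_mult_left_zero tendsto_mult_right_zero summable_LIMSEQ_zero summ)
  qed
  \<comment> \<open>The telescoping sum equals its first term v(0) = p because v tends to 0.\<close>
  have sums_v: "(\<lambda>n. v p n - v p (Suc n)) sums p" for p
    using telescope_sums'[OF v_lim, of p]
    by (simp add: v_def diag_op_def)
  interpret c: bounded_linear "cscale k :: 'e \<times> 'e \<Rightarrow> _" for k by (rule bounded_linear_cscale)
  interpret d: bounded_linear "diag_op A" for A :: "'e \<Rightarrow>\<^sub>L 'e" by (rule bounded_linear_diag_op)
  define S where "S p = suminf (u p)" for p
  have "bounded_linear S"
  proof (rule bounded_linear_intro[where K = "suminf b"])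
    fix p q and r :: real
    have "u (p + q) = (\<lambda>n. u p n + u q n)" for n
      by (simp add: u_def v_def c.add d.add fun_eq_iff)
    then show "S (p + q) = S p + S q"
      by (simp add: S_def suminf_add summ_u)
    have "u (r *\<^sub>R p) = (\<lambda>n. r *\<^sub>R u p n)" for n
      by (simp add: u_def v_def c.scaleR d.scaleR fun_eq_iff)
    then show "S (r *\<^sub>R p) = r *\<^sub>R S p"
      by (simp add: S_def suminf_scaleR_right summ_u)
    have "norm (S p) \<le> (\<Sum>n. b n * norm p)"
      unfolding S_def by (intro norm_suminf_le_suminf summ_u norm_u summable_mult2 summ_b)
    then show "norm (S p) \<le> norm p * suminf b"
      using suminf_mult2[OF summ_b, of "norm p"] by (simp add: mult.commute)
  qed
  moreover have "complex_shift z T (S p) = p" for p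
  proof -
    have "cscale z (u p n) - diag_op T (u p n) = v p n - v p (Suc n)" for n
      by (simp add: u_def v_def cscale_cscale zw diag_op_cscale diag_op_pow_Suc(1)
          mult.assoc[symmetric])
    moreover have "complex_shift z T (S p) = (\<Sum>n. cscale z (u p n) - diag_op T (u p n))"
      unfolding complex_shift_eq S_def
      by (simp add: suminf_diff c.summable d.summable c.suminf d.suminf summ_u)
    ultimately show ?thesis using sums_v[of p] by (simp add: sums_iff)
  qed
  moreover have "S (complex_shift z T p) = p" for p
  proof -
    have "u (complex_shift z T p) = (\<lambda>n. v p n - v p (Suc n))"
      by (simp add: fun_eq_iff zw u_def v_def complex_shift_eq c.diff d.diff diag_op_cscale cscale_cscale
          diag_op_pow_Suc(2) algebra_simps)
    then show ?thesis using sums_v[of p] by (simp add: S_def sums_iff)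
  qed
  ultimately show ?thesis
    unfolding op_spectrum_def by (auto simp: fun_eq_iff)
qed

section \<open>Function spaces\<close>

lemma bcontfun_Cauchy_convergent:
  fixes X :: "nat \<Rightarrow> 'a::topological_space \<Rightarrow>\<^sub>C 'b::complete_space"
  assumes "Cauchy X"
  shows "convergent X"
proof -
  have "uniformly_Cauchy_on UNIV (\<lambda>n. apply_bcontfun (X n))"
  proof (rule uniformly_Cauchy_onI)
    fix e :: real assume "0 < e"
    then obtain M where "\<And>m n. m \<ge> M \<Longrightarrow> n \<ge> M \<Longrightarrow> dist (X m) (X n) < e"
      using assms unfolding Cauchy_def by blast
    then show "\<exists>M. \<forall>a\<in>UNIV. \<forall>m\<ge>M. \<forall>n\<ge>M. dist (apply_bcontfun (X m) a) (apply_bcontfun (X n) a) < e"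
      using le_less_trans[OF dist_bounded] by blast
  qed
  then obtain g where "uniform_limit UNIV (\<lambda>n. apply_bcontfun (X n)) g sequentially"
    using Cauchy_uniformly_convergent uniformly_convergent_on_def by blast
  then obtain h where "X \<longlonglongrightarrow> h"
    by (rule uniform_limit_bcontfunE[OF _ sequentially_bot])
  then show ?thesis by (rule convergentI)
qed

text \<open>Uniform limits preserve continuity on the accumulation points, boundedness and vanishing
  elsewhere, so the limit function is again an element of the space.\<close>

lemma acc_fun_Cauchy_convergent:
  fixes X :: "nat \<Rightarrow> 'a::topological_space acc_fun"
  assumes "Cauchy X"
  shows "convergent X"
proof -
  have dist_le: "dist (apply_acc_fun f a) (apply_acc_fun g a) \<le> dist f g" for f g :: "'a acc_fun" and a
    using abs_apply_acc_fun_le[of "f - g" a] by (simp add: dist_norm minus_acc_fun.rep_eq)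
  have "uniformly_Cauchy_on UNIV (\<lambda>n. apply_acc_fun (X n))"
  proof (rule uniformly_Cauchy_onI)
    fix e :: real assume "0 < e"
    then obtain M where "\<And>m n. m \<ge> M \<Longrightarrow> n \<ge> M \<Longrightarrow> dist (X m) (X n) < e"
      using assms unfolding Cauchy_def by blast
    then show "\<exists>M. \<forall>a\<in>UNIV. \<forall>m\<ge>M. \<forall>n\<ge>M. dist (apply_acc_fun (X m) a) (apply_acc_fun (X n) a) < e"
      using le_less_trans[OF dist_le] by blast
  qed
  then obtain g where g: "uniform_limit UNIV (\<lambda>n. apply_acc_fun (X n)) g sequentially"
    using Cauchy_uniformly_convergent uniformly_convergent_on_def by blast
  have acc: "continuous_on acc_points (apply_acc_fun f)" "bounded (range (apply_acc_fun f))"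
    "a \<notin> acc_points \<Longrightarrow> apply_acc_fun f a = 0" for f :: "'a acc_fun" and a
    using apply_acc_fun[of f] by auto
  have "g a = 0" if "a \<notin> acc_points" for a
    using tendsto_uniform_limitI[OF g, of a] by (simp add: acc(3)[OF that] LIMSEQ_const_iff)
  moreover have "continuous_on acc_points g"
    by (rule uniform_limit_theorem[OF _ uniform_limit_on_subset[OF g]]) (auto simp: acc)
  moreover have "bounded (range g)"
    using uniform_limit_bounded[OF g] acc by (auto simp: trivial_limit_sequentially)
  ultimately have app: "apply_acc_fun (Acc_fun g) = g"
    by (intro Acc_fun_inverse) auto
  have "X \<longlonglongrightarrow> Acc_fun g"
  proof (rule metric_LIMSEQ_I)
    fix e :: real assume "0 < e"
    then obtain N where N: "\<And>n a. n \<ge> N \<Longrightarrow> dist (apply_acc_fun (X n) a) (g a) < e / 2"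
      using uniform_limitD[OF g, of "e / 2"] by (auto simp: eventually_sequentially)
    have "dist (X n) (Acc_fun g) < e" if "n \<ge> N" for n
    proof -
      have "norm (X n - Acc_fun g) \<le> e / 2"
        using N[OF that] by (intro norm_acc_fun_le) (simp add: minus_acc_fun.rep_eq app dist_real_def less_imp_le)
      then show ?thesis using \<open>0 < e\<close> by (simp add: dist_norm)
    qed
    then show "\<exists>N. \<forall>n\<ge>N. dist (X n) (Acc_fun g) < e" by blast
  qed
  then show ?thesis by (rule convergentI)
qed

lemma bcontfun_of_continuous:
  fixes f :: "'a::topological_space \<Rightarrow> real"
  assumes "compact (UNIV :: 'a set)" "continuous_on UNIV f"
  shows "apply_bcontfun (Bcontfun f) = f"
  using assms by (intro Bcontfun_inverse)
    (auto simp: bcontfun_def intro: compact_imp_bounded compact_continuous_image)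

text \<open>Urysohn's lemma for a compact Hausdorff space. Such a function singles out one entry of
  the left eigenvector, which proves the associated functional on C(A) non-zero.\<close>

lemma separating_bcontfun:
  fixes p :: "'a::t2_space"
  assumes "compact (UNIV :: 'a set)" "finite S" "p \<notin> S"
  shows "\<exists>f :: 'a \<Rightarrow>\<^sub>C real. apply_bcontfun f p = 1 \<and> (\<forall>q\<in>S. apply_bcontfun f q = 0)"
proof -
  have "normal_space (euclidean :: 'a topology)"
  proof (rule compact_Hausdorff_or_regular_imp_normal_space)
    have "Hausdorff_space (euclidean :: 'a topology)"
      unfolding Hausdorff_space_def disjnt_def using hausdorff by auto
    then show "Hausdorff_space (euclidean :: 'a topology) \<or> regular_space (euclidean :: 'a topology)" ..
  qed (use assms(1) in \<open>simp add: compact_space_def\<close>)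
  then obtain f :: "'a \<Rightarrow> real" where "continuous_map euclidean euclideanreal f" "f ` {p} \<subseteq> {1}" "f ` S \<subseteq> {0}"
    by (rule Urysohn_lemma_alt[where S = "{p}" and T = S and a = 1 and b = 0])
      (use assms(2,3) in \<open>auto simp: finite_imp_closed\<close>)
  then show ?thesis
    using bcontfun_of_continuous[OF assms(1), of f] by (intro exI[of _ "Bcontfun f"]) auto
qed

section \<open>Spectra\<close>

text \<open>For c strictly between \<rho> and |z|, the norm of T^n is eventually at most c^n, so a
  geometric series of ratio c / |z| dominates the Neumann series.\<close>

lemma op_spectrum_cmod_le:
  fixes T :: "'e::real_normed_vector \<Rightarrow>\<^sub>L 'e"
  assumes complete: "\<And>X :: nat \<Rightarrow> 'e. Cauchy X \<Longrightarrow> convergent X"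
    and lim: "(\<lambda>n. root n (norm (op_pow T n))) \<longlonglongrightarrow> \<rho>" and z: "z \<in> op_spectrum T"
  shows "cmod z \<le> \<rho>"
proof (rule ccontr)
  assume "\<not> cmod z \<le> \<rho>"
  then have less: "\<rho> < cmod z" by simp
  have "0 \<le> \<rho>"
    by (rule LIMSEQ_le_const[OF lim]) (auto intro!: exI[of _ 0] real_root_ge_zero)
  with less have "z \<noteq> 0" by auto
  obtain c where c: "\<rho> < c" "c < cmod z" using dense[OF less] by blast
  have "eventually (\<lambda>n. norm (norm (op_pow T n) / cmod z ^ n) \<le> (c / cmod z) ^ n) sequentially"
    using order_tendstoD(2)[OF lim c(1)] eventually_ge_at_top[of 1]
  proof eventually_elim
    case (elim n)
    have "norm (op_pow T n) = root n (norm (op_pow T n)) ^ n" using elim by simp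
    also have "\<dots> \<le> c ^ n" using elim by (intro power_mono) auto
    finally show ?case by (simp add: power_divide divide_right_mono)
  qed
  then have "summable (\<lambda>n. norm (op_pow T n) / cmod z ^ n)"
    by (rule summable_comparison_test_ev) (use c \<open>0 \<le> \<rho>\<close> in \<open>auto intro!: summable_geometric simp: divide_less_eq\<close>)
  then show False
    using not_in_op_spectrum[OF complete \<open>z \<noteq> 0\<close>] z by blast
qed

text \<open>The alternative \<rho> = 0 allows for an empty spectrum; there the 0 inserted in the
  definition supplies the supremum.\<close>

lemma op_spectral_radius_eqI:
  assumes "\<And>z. z \<in> op_spectrum T \<Longrightarrow> cmod z \<le> \<rho>"
    and "0 \<le> \<rho>" "\<rho> = 0 \<or> (\<exists>z\<in>op_spectrum T. \<rho> \<le> cmod z)"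
  shows "op_spectral_radius T = \<rho>"
proof (rule antisym)
  show "op_spectral_radius T \<le> \<rho>"
    unfolding op_spectral_radius_def using assms by (intro cSup_least) auto
  have bdd: "bdd_above (insert 0 (cmod ` op_spectrum T))"
    using assms by (intro bdd_aboveI[of _ \<rho>]) auto
  from assms(3) obtain x where "x \<in> insert 0 (cmod ` op_spectrum T)" "\<rho> \<le> x" by blast
  then show "\<rho> \<le> op_spectral_radius T"
    unfolding op_spectral_radius_def using bdd by (rule cSup_upper2)
qed

text \<open>The complex linear extension of \<open>\<phi>\<close> to the complexification annihilates the range of \<open>z - T\<close>, so
  \<open>z - T\<close> is not surjective.\<close>

lemma in_op_spectrum_of_left_eigenfunctional:
  fixes T :: "'e::real_normed_vector \<Rightarrow>\<^sub>L 'e" and \<phi> :: "'e \<Rightarrow> complex"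
  assumes lin: "\<And>x y. \<phi> (x + y) = \<phi> x + \<phi> y" "\<And>r x. \<phi> (r *\<^sub>R x) = of_real r * \<phi> x"
    and eig: "\<And>x. \<phi> (T x) = z * \<phi> x" and nz: "\<phi> x0 \<noteq> 0"
  shows "z \<in> op_spectrum T"
proof -
  define \<Phi> where "\<Phi> p = \<phi> (fst p) + \<i> * \<phi> (snd p)" for p
  have diff: "\<phi> (x - y) = \<phi> x - \<phi> y" for x y
    using lin(1)[of "x - y" y] by simp
  have zero: "\<Phi> (complex_shift z T p) = 0" for p
  proof -
    have "\<Phi> (complex_shift z T p) = (of_real (Re z) + \<i> * of_real (Im z) - z) * \<Phi> p"
      by (simp add: \<Phi>_def complex_shift_def case_prod_beta lin diff eig algebra_simps)
    then show ?thesis by (simp flip: complex_eq)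
  qed
  have "\<phi> 0 = 0" using lin(2)[of 0 0] by simp
  then have "\<Phi> (x0, 0) \<noteq> 0" using nz by (simp add: \<Phi>_def)
  then have "complex_shift z T \<circ> S \<noteq> id" for S
    using zero[of "S (x0, 0)"] by (auto dest: fun_cong[of _ _ "(x0, 0)"])
  then show ?thesis by (simp add: op_spectrum_def)
qed

section \<open>Growth of matrix powers\<close>

lemma eigenvalue_smult_mat:
  fixes A :: "complex mat"
  assumes "A \<in> carrier_mat n n" "eigenvalue (c \<cdot>\<^sub>m A) k" "c \<noteq> 0"
  shows "eigenvalue A (k / c)"
proof -
  obtain v where v: "v \<in> carrier_vec n" "v \<noteq> 0\<^sub>v n" "(c \<cdot>\<^sub>m A) *\<^sub>v v = k \<cdot>\<^sub>v v"
    using assms unfolding eigenvalue_def eigenvector_def by auto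
  have "(c \<cdot>\<^sub>m A) *\<^sub>v v = c \<cdot>\<^sub>v (A *\<^sub>v v)"
    using v(1) assms(1) by (intro eq_vecI) auto
  with v(3) have "c \<cdot>\<^sub>v (A *\<^sub>v v) = k \<cdot>\<^sub>v v" by simp
  then have "(1 / c) \<cdot>\<^sub>v (c \<cdot>\<^sub>v (A *\<^sub>v v)) = (1 / c) \<cdot>\<^sub>v (k \<cdot>\<^sub>v v)" by simp
  then have "A *\<^sub>v v = (k / c) \<cdot>\<^sub>v v"
    using assms(3) by (simp add: smult_smult_assoc)
  then show ?thesis
    unfolding eigenvalue_def eigenvector_def using v assms(1) by auto
qed

text \<open>Here \<open>z\<close> is an eigenvalue of maximal modulus; the transpose has the same
  characteristic polynomial, hence a left eigenvector exists. For c > |z| the matrix A / c has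
  spectral radius below 1, so its powers are bounded by the Jordan normal form. The recursion for
  \<open>b\<close> describes the entries of A^k without mentioning matrices.\<close>

lemma dominant_left_eigenvector_nat:
  fixes a :: "nat \<Rightarrow> nat \<Rightarrow> real" and b :: "nat \<Rightarrow> nat \<Rightarrow> nat \<Rightarrow> real"
  assumes "n > 0"
    and b0: "\<And>i j. i < n \<Longrightarrow> j < n \<Longrightarrow> b 0 i j = (if i = j then 1 else 0)"
    and bSuc: "\<And>k i j. i < n \<Longrightarrow> j < n \<Longrightarrow> b (Suc k) i j = (\<Sum>l<n. b k i l * a l j)"
  obtains z :: complex and w where "\<exists>i<n. w i \<noteq> 0"
    "\<And>j. j < n \<Longrightarrow> (\<Sum>i<n. w i * of_real (a i j)) = z * w j"
    "\<And>c. c > cmod z \<Longrightarrow> \<exists>C. \<forall>k. \<forall>i<n. \<forall>j<n. \<bar>b k i j\<bar> \<le> C * c ^ k"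
proof -
  define A where "A = Matrix.mat n n (\<lambda>(i, j). complex_of_real (a i j))"
  have A [simp]: "A \<in> carrier_mat n n" by (simp add: A_def)
  obtain z where z: "z \<in> spectrum A" "spectral_radius A = cmod z"
    using spectral_radius_mem_max(1)[OF A \<open>n > 0\<close>] by auto
  have "eigenvalue (transpose_mat A) z"
    using z(1) eigenvalue_root_char_poly[OF A] eigenvalue_root_char_poly[of "transpose_mat A" n] A
    by (simp add: spectrum_def char_poly_transpose_mat[OF A])
  then obtain v where v: "v \<in> carrier_vec n" "v \<noteq> 0\<^sub>v n" "transpose_mat A *\<^sub>v v = z \<cdot>\<^sub>v v"
    unfolding eigenvalue_def eigenvector_def using A by auto
  define w where "w i = vec_index v i" for i
  show ?thesis
  proof (rule that[of w z])
    show "\<exists>i<n. w i \<noteq> 0"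
      using v(1,2) unfolding w_def by (metis carrier_vecD eq_vecI index_zero_vec)
    show "(\<Sum>i<n. w i * of_real (a i j)) = z * w j" if "j < n" for j
    proof -
      have "vec_index (transpose_mat A *\<^sub>v v) j = z * w j"
        using v that by (simp add: w_def)
      moreover have "vec_index (transpose_mat A *\<^sub>v v) j = (\<Sum>i<n. w i * of_real (a i j))"
        using v(1) that
        by (auto simp: A_def w_def scalar_prod_def lessThan_atLeast0 mult.commute intro!: sum.cong)
      ultimately show ?thesis by simp
    qed
    show "\<exists>C. \<forall>k. \<forall>i<n. \<forall>j<n. \<bar>b k i j\<bar> \<le> C * c ^ k" if c: "c > cmod z" for c
    proof -
      have "c > 0" using c norm_ge_zero[of z] by linarith
      define B where "B = complex_of_real (1 / c) \<cdot>\<^sub>m A"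
      have B [simp]: "B \<in> carrier_mat n n" by (simp add: B_def)
      have entries: "i < n \<Longrightarrow> j < n \<Longrightarrow> (B ^\<^sub>m k) $$ (i, j) = of_real (b k i j / c ^ k)" for k i j
      proof (induction k arbitrary: i j)
        case 0
        then show ?case using carrier_matD[OF B] by (simp add: b0)
      next
        case (Suc k)
        have "(B ^\<^sub>m Suc k) $$ (i, j) = (\<Sum>l<n. (B ^\<^sub>m k) $$ (i, l) * B $$ (l, j))"
          using Suc.prems carrier_matD[OF B] carrier_matD[OF pow_carrier_mat[OF B, of k]]
          by (simp add: scalar_prod_def lessThan_atLeast0)
        also have "\<dots> = (\<Sum>l<n. of_real (b k i l / c ^ k) * of_real (a l j / c))"
          using Suc by (intro sum.cong) (auto simp: B_def A_def)
        also have "\<dots> = of_real (b (Suc k) i j / c ^ Suc k)"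
          using Suc.prems by (simp add: bSuc sum_divide_distrib mult_ac)
        finally show ?case .
      qed
      obtain k where k: "eigenvalue B k" "spectral_radius B = cmod k"
        using spectral_radius_mem_max(1)[OF B \<open>n > 0\<close>] by (auto simp: spectrum_def)
      \<comment> \<open>Multiplying by c turns an eigenvalue of A / c into one of A, whose modulus
        is at most |z| < c.\<close>
      have "eigenvalue A (k / complex_of_real (1 / c))"
        using \<open>c > 0\<close> by (intro eigenvalue_smult_mat[OF A]) (use k B_def in auto)
      then have "cmod (k / complex_of_real (1 / c)) \<le> cmod z"
        using spectral_radius_mem_max(2)[OF A \<open>n > 0\<close>] z(2) by (auto simp: spectrum_def)
      then have "cmod k * c \<le> cmod z"
        using \<open>c > 0\<close> by (simp add: norm_mult norm_divide)
      with c have "cmod k * c < 1 * c" by simp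
      then have "spectral_radius B < 1"
        using \<open>c > 0\<close> unfolding k(2) by (simp only: mult_less_cancel_right_pos)
      then obtain C where C: "\<And>k. norm_bound (B ^\<^sub>m k) C"
        using spectral_radius_jnf_norm_bound_less_1_upper_triangular[OF B] by blast
      have "\<bar>b k i j\<bar> \<le> C * c ^ k" if "i < n" "j < n" for k i j
      proof -
        have "norm ((B ^\<^sub>m k) $$ (i, j)) \<le> C"
          using C[of k] that carrier_matD[OF pow_carrier_mat[OF B, of k]]
          unfolding norm_bound_def by simp
        then show ?thesis
          using \<open>c > 0\<close> by (simp add: entries[OF that] norm_divide norm_power field_simps)
      qed
      then show ?thesis by blast
    qed
  qed
qed

text \<open>An enumeration \<open>e\<close> of the index set, with inverse \<open>d\<close>,
  transports the result from matrices to arbitrary finite index sets.\<close>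

lemma dominant_left_eigenvector:
  fixes a :: "'s \<Rightarrow> 's \<Rightarrow> real" and b :: "nat \<Rightarrow> 's \<Rightarrow> 's \<Rightarrow> real"
  assumes "finite S" "S \<noteq> {}"
    and b0: "\<And>p q. p \<in> S \<Longrightarrow> q \<in> S \<Longrightarrow> b 0 p q = (if p = q then 1 else 0)"
    and bSuc: "\<And>k p q. p \<in> S \<Longrightarrow> q \<in> S \<Longrightarrow> b (Suc k) p q = (\<Sum>l\<in>S. b k p l * a l q)"
  obtains z :: complex and w where "\<exists>p\<in>S. w p \<noteq> 0"
    "\<And>q. q \<in> S \<Longrightarrow> (\<Sum>p\<in>S. w p * of_real (a p q)) = z * w q"
    "\<And>c. c > cmod z \<Longrightarrow> \<exists>C. \<forall>k. \<forall>p\<in>S. \<forall>q\<in>S. \<bar>b k p q\<bar> \<le> C * c ^ k"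
proof -
  define n where "n = card S"
  have "n > 0" using assms by (simp add: n_def card_gt_0_iff)
  obtain e where e: "bij_betw e {..<n} S"
    using ex_bij_betw_nat_finite[OF assms(1)] by (auto simp: n_def lessThan_atLeast0)
  define d where "d = inv_into {..<n} e"
  have S: "e ` {..<n} = S" "inj_on e {..<n}" using e by (auto simp: bij_betw_def)
  have ed: "d p < n" "e (d p) = p" if "p \<in> S" for p
    using inv_into_into[of p e "{..<n}"] f_inv_into_f[of p e "{..<n}"] that S(1)
    by (auto simp: d_def)
  have de: "e i \<in> S" "d (e i) = i" if "i < n" for i
    using that S by (auto simp: d_def inv_into_f_f)
  have reindex: "(\<Sum>p\<in>S. g p) = (\<Sum>i<n. g (e i))" for g :: "'s \<Rightarrow> 'b::comm_monoid_add"
    using sum.reindex_bij_betw[OF e, of g] by simp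
  obtain z :: complex and w where w: "\<exists>i<n. w i \<noteq> 0"
    "\<And>j. j < n \<Longrightarrow> (\<Sum>i<n. w i * of_real (a (e i) (e j))) = z * w j"
    "\<And>c. c > cmod z \<Longrightarrow> \<exists>C. \<forall>k. \<forall>i<n. \<forall>j<n. \<bar>b k (e i) (e j)\<bar> \<le> C * c ^ k"
  proof (rule dominant_left_eigenvector_nat[of n "\<lambda>k i j. b k (e i) (e j)" "\<lambda>i j. a (e i) (e j)"])
    show "b 0 (e i) (e j) = (if i = j then 1 else 0)" if "i < n" "j < n" for i j
      using that b0[of "e i" "e j"] de inj_on_eq_iff[OF S(2), of i j] by simp
  qed (use \<open>n > 0\<close> de bSuc reindex in auto)
  show ?thesis
  proof (rule that[of "\<lambda>p. w (d p)" z])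
    obtain i where "i < n" "w i \<noteq> 0" using w(1) by blast
    then show "\<exists>p\<in>S. w (d p) \<noteq> 0" using de[of i] by (intro bexI[of _ "e i"]) auto
    show "(\<Sum>p\<in>S. w (d p) * of_real (a p q)) = z * w (d q)" if "q \<in> S" for q
      using w(2)[of "d q"] ed[OF that] de by (simp add: reindex)
    show "\<exists>C. \<forall>k. \<forall>p\<in>S. \<forall>q\<in>S. \<bar>b k p q\<bar> \<le> C * c ^ k" if c: "c > cmod z" for c
    proof -
      obtain C where C: "\<And>k i j. i < n \<Longrightarrow> j < n \<Longrightarrow> \<bar>b k (e i) (e j)\<bar> \<le> C * c ^ k"
        using w(3)[OF c] by blast
      have "\<bar>b k p q\<bar> \<le> C * c ^ k" if "p \<in> S" "q \<in> S" for k p q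
        using C[of "d p" "d q" k] ed that by simp
      then show ?thesis by blast
    qed
  qed
qed

section \<open>Reduced substitutions\<close>

text \<open>Each letter is charged to the sets \<open>U q\<close> containing it; interchanging the
  sums produces exactly the quantities bounded in condition (4).\<close>

lemma sum_mset_le_sum_filter:
  fixes f g :: "_ \<Rightarrow> nat"
  assumes "finite S" "\<And>b. b \<in># m \<Longrightarrow> f b \<le> (\<Sum>q\<in>S. if b \<in> U q then g q else 0)"
  shows "(\<Sum>b\<in>#m. f b) \<le> (\<Sum>q\<in>S. size {#b \<in># m. b \<in> U q#} * g q)"
  using assms(2)
proof (induction m)
  case (add b m)
  have "(\<Sum>b\<in>#add_mset b m. f b) \<le> (\<Sum>q\<in>S. if b \<in> U q then g q else 0) +
      (\<Sum>q\<in>S. size {#b \<in># m. b \<in> U q#} * g q)"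
    using add by (simp add: add_mono)
  also have "\<dots> = (\<Sum>q\<in>S. size {#b \<in># add_mset b m. b \<in> U q#} * g q)"
    unfolding sum.distrib[symmetric] by (intro sum.cong) (auto simp: algebra_simps)
  finally show ?case .
qed simp

text \<open>Fixes one choice of neighbourhoods, so that all estimates refer to the same
  \<open>U\<close>.\<close>

locale reduced_substitution =
  fixes \<tau> :: "'a::t2_space \<Rightarrow> 'a multiset" and U :: "'a \<Rightarrow> 'a set"
  assumes compact_UNIV: "compact (UNIV :: 'a set)"
    and finite_acc: "finite (acc_points :: 'a set)"
    and substitution: "substitution \<tau>"
    and open_mem_U: "\<forall>p\<in>acc_points. open (U p) \<and> p \<in> U p"
    and empty_outside: "\<forall>a. a \<notin> (\<Union>p\<in>acc_points. U p) \<longrightarrow> \<tau> a = {#}"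
    and no_common_letter: "\<forall>p\<in>acc_points. \<forall>b.
      \<not> (\<exists>U'. open U' \<and> p \<in> U' \<and> U' \<subseteq> U p \<and> (\<forall>u\<in>U'. b \<in># \<tau> u))"
    and size_le: "\<forall>p\<in>acc_points. \<forall>a\<in>U p. size (\<tau> a) \<le> size (\<tau> p)"
    and size_filter_le: "\<forall>p\<in>acc_points. \<forall>q\<in>acc_points. \<forall>u\<in>U p.
      size {#b \<in># \<tau> u. b \<in> U q#} \<le> count (\<tau> p) q"
begin

section \<open>Locally constant letter counts and lengths of iterates\<close>

lemma continuous_sum_subst_iter:
  assumes "continuous_on UNIV (f :: 'a \<Rightarrow> real)"
  shows "continuous_on UNIV (\<lambda>a. \<Sum>b\<in>#subst_iter \<tau> n a. f b)"
proof (induction n)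
  case (Suc n)
  show ?case
    using continuous_on_sum_subst[OF substitution_imp_mset_substitution[OF substitution] Suc]
    by (simp add: subst_iter_Suc sum_mset_sum_mset)
qed (simp add: assms)

text \<open>A continuous function with natural values is locally constant: the value k is singled
  out by the open interval from k - 1 to k + 1.\<close>

lemma open_sum_subst_iter_eq:
  fixes g :: "'a \<Rightarrow> nat"
  assumes "continuous_on UNIV (\<lambda>b. real (g b))"
  shows "open {a. (\<Sum>b\<in>#subst_iter \<tau> n a. g b) = k}"
proof -
  have "{a. (\<Sum>b\<in>#subst_iter \<tau> n a. g b) = k} =
      (\<lambda>a. \<Sum>b\<in>#subst_iter \<tau> n a. real (g b)) -` {real k - 1<..<real k + 1}"
  proof -
    have eq: "(\<Sum>b\<in>#m. real (g b)) = real (\<Sum>b\<in>#m. g b)" for m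
      by (induction m) auto
    have "(\<Sum>b\<in>#m. g b) = k \<longleftrightarrow> (\<Sum>b\<in>#m. real (g b)) \<in> {real k - 1<..<real k + 1}" for m
      unfolding eq greaterThanLessThan_iff by linarith
    then show ?thesis by blast
  qed
  moreover have "open \<dots>"
    using continuous_sum_subst_iter[OF assms] by (intro open_vimage) auto
  ultimately show ?thesis by simp
qed

text \<open>A finite set of isolated points is both open and closed.\<close>

lemma continuous_indicator_isolated:
  fixes B :: "'a set"
  assumes "finite B" "\<And>b. b \<in> B \<Longrightarrow> isolated b"
  shows "continuous_on UNIV (\<lambda>a. indicator B a :: real)"
proof -
  have "open (\<Union>b\<in>B. {b})" using assms(2) unfolding isolated_def by blast
  then have "open B" by simp
  moreover have "closed B" using assms(1) by (rule finite_imp_closed)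
  ultimately have "continuous_on (B \<union> - B) (\<lambda>a. indicator B a :: real)"
    by (intro continuous_on_open_Un)
      (auto intro: continuous_on_eq[OF continuous_on_const])
  then show ?thesis by simp
qed

lemma sum_mset_indicator: "(\<Sum>b\<in>#m. indicator B b :: nat) = size {#b \<in># m. b \<in> B#}"
  by (induction m) auto

lemma open_size_subst_iter_eq: "open {a. size (subst_iter \<tau> n a) = k}"
  using open_sum_subst_iter_eq[of "\<lambda>_. 1" n k] by simp

text \<open>For a singleton \<open>B\<close> this makes the count of an isolated letter locally
  constant; with k = 0 it lets images near a point avoid \<open>B\<close>.\<close>

lemma open_size_filter_eq:
  assumes "finite B" "\<And>b. b \<in> B \<Longrightarrow> isolated b"
  shows "open {a. size {#b \<in># subst_iter \<tau> n a. b \<in> B#} = k}"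
proof -
  have "continuous_on UNIV (\<lambda>a. real (indicator B a))"
    using continuous_indicator_isolated[OF assms]
    by (rule continuous_on_eq) (auto simp: indicator_def)
  then show ?thesis
    using open_sum_subst_iter_eq[of "indicator B" n k] by (simp add: sum_mset_indicator)
qed

text \<open>An isolated letter of \<tau> p would occur equally often in \<tau> u for all u in a
  neighbourhood of p, contradicting condition (3).\<close>

lemma letter_of_acc_point:
  assumes "p \<in> acc_points" "b \<in># \<tau> p"
  shows "b \<in> acc_points"
proof (rule ccontr)
  assume "b \<notin> acc_points"
  then have b: "isolated b" by (simp add: acc_points_def)
  define V where "V = {a. count (\<tau> a) b = count (\<tau> p) b} \<inter> U p"
  have eq: "size {#c \<in># subst_iter \<tau> 1 a. c \<in> {b}#} = count (\<tau> a) b" for a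
  proof -
    have "size {#c \<in># m. c \<in> {b}#} = count m b" for m by (induction m) auto
    then show ?thesis by (simp add: subst_iter_Suc)
  qed
  have "open {a. size {#c \<in># subst_iter \<tau> 1 a. c \<in> {b}#} = count (\<tau> p) b}"
    using b by (intro open_size_filter_eq) auto
  then have "open V"
    unfolding V_def eq using open_mem_U assms(1) by (intro open_Int) auto
  moreover have "p \<in> V" "V \<subseteq> U p"
    using open_mem_U assms(1) by (auto simp: V_def)
  ultimately obtain u where "u \<in> V" "b \<notin># \<tau> u"
    using no_common_letter assms(1) by blast
  then have "count (\<tau> u) b = count (\<tau> p) b" unfolding V_def by blast
  then show False using assms(2) \<open>b \<notin># \<tau> u\<close> by (metis not_in_iff)
qed

lemma letter_of_subst_iter_acc_point:
  "p \<in> acc_points \<Longrightarrow> b \<in># subst_iter \<tau> n p \<Longrightarrow> b \<in> acc_points"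
  by (induction n arbitrary: p) (auto simp: subst_iter_Suc dest: letter_of_acc_point)

lemma subst_iter_acc_subst:
  "p \<in> acc_points \<Longrightarrow> subst_iter (acc_subst \<tau>) n p = subst_iter \<tau> n p"
proof (induction n arbitrary: p)
  case (Suc n)
  then show ?case
    using letter_of_acc_point
    by (auto simp: subst_iter_Suc acc_subst_def intro!: arg_cong[of _ _ sum_mset] image_mset_cong)
qed simp

lemma subst_iter_outside:
  assumes "a \<notin> (\<Union>p\<in>acc_points. U p)" "n \<ge> 1"
  shows "subst_iter \<tau> n a = {#}"
  using assms empty_outside by (cases n) (auto simp: subst_iter_Suc)

text \<open>Among the letters of \<tau> a, those outside all neighbourhoods contribute nothing to
  later iterates, and those in \<open>U q\<close> contribute at most as much as q by induction.
  Condition (4) bounds the number of the latter by the count of q in \<tau> p.\<close>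

lemma size_subst_iter_le:
  "p \<in> acc_points \<Longrightarrow> a \<in> U p \<Longrightarrow> size (subst_iter \<tau> n a) \<le> size (subst_iter \<tau> n p)"
proof (induction n arbitrary: p a)
  case (Suc n)
  show ?case
  \<comment> \<open>A letter outside all neighbourhoods still counts 1 in the zeroth iterate, so the
    first step rests on the bound for total lengths instead.\<close>
  proof (cases "n = 0")
    case True
    then show ?thesis using size_le Suc.prems by (simp add: subst_iter_Suc)
  next
    case False
    let ?s = "\<lambda>b. size (subst_iter \<tau> n b)"
    have "?s b \<le> (\<Sum>q\<in>acc_points. if b \<in> U q then ?s q else 0)" for b
    proof (cases "b \<in> (\<Union>q\<in>acc_points. U q)")
      case True
      then obtain q where "q \<in> acc_points" "b \<in> U q" by blast
      then show ?thesis
        using Suc.IH[of q b] member_le_sum[of q acc_points "\<lambda>q. if b \<in> U q then ?s q else 0"] finite_acc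
        by auto
    qed (use False subst_iter_outside in simp)
    then have "(\<Sum>b\<in>#\<tau> a. ?s b) \<le> (\<Sum>q\<in>acc_points. size {#b \<in># \<tau> a. b \<in> U q#} * ?s q)"
      by (intro sum_mset_le_sum_filter finite_acc)
    also have "\<dots> \<le> (\<Sum>q\<in>acc_points. count (\<tau> p) q * ?s q)"
      using Suc.prems size_filter_le by (intro sum_mono mult_right_mono) auto
    also have "\<dots> = (\<Sum>b\<in>#\<tau> p. ?s b)"
      using letter_of_acc_point[OF Suc.prems(1)]
      by (subst sum_mset_eq_sum_count[OF finite_acc]) auto
    finally show ?thesis unfolding subst_iter_Suc size_sum_mset .
  qed
qed simp

section \<open>Operator norms as maximal lengths of iterates\<close>

definition max_size :: "nat \<Rightarrow> nat" where
  "max_size n = Max (insert 0 ((\<lambda>a. size (subst_iter \<tau> n a)) ` acc_points))"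

lemma max_size_eq:
  "max_size n = Max (insert 0 ((\<lambda>a. size (subst_iter (acc_subst \<tau>) n a)) ` acc_points))"
  by (simp add: max_size_def subst_iter_acc_subst cong: image_cong_simp)

lemma size_le_max_size: "p \<in> acc_points \<Longrightarrow> size (subst_iter \<tau> n p) \<le> max_size n"
  unfolding max_size_def using finite_acc by (intro Max_ge) auto

lemma max_size_attained:
  assumes "max_size n \<noteq> 0"
  obtains p where "p \<in> acc_points" "size (subst_iter \<tau> n p) = max_size n"
proof -
  have "max_size n \<in> insert 0 ((\<lambda>a. size (subst_iter \<tau> n a)) ` acc_points)"
    unfolding max_size_def using finite_acc by (intro Max_in) auto
  then show ?thesis using assms that by auto
qed

text \<open>The case n = 0 without accumulation points is excluded: there every image has length 1,
  while the empty maximum is 0.\<close>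

lemma size_subst_iter_le_max_size:
  assumes "n \<ge> 1 \<or> (acc_points :: 'a set) \<noteq> {}"
  shows "size (subst_iter \<tau> n a) \<le> max_size n"
proof (cases "a \<in> (\<Union>p\<in>acc_points. U p)")
  case True
  then show ?thesis using size_subst_iter_le size_le_max_size by (meson UN_E order_trans)
next
  case False
  show ?thesis
  proof (cases "n = 0")
    case True
    then obtain p :: 'a where "p \<in> acc_points" using assms by auto
    then show ?thesis using size_le_max_size[of p n] True by simp
  qed (use False subst_iter_outside in simp)
qed

lemma max_size_le_real:
  assumes "0 \<le> c" "\<And>p. p \<in> acc_points \<Longrightarrow> real (size (subst_iter \<tau> n p)) \<le> c"
  shows "real (max_size n) \<le> c"
proof (cases "max_size n = 0")
  case False
  then obtain p where "p \<in> acc_points" "size (subst_iter \<tau> n p) = max_size n"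
    by (rule max_size_attained)
  then show ?thesis using assms(2)[of p] by simp
qed (use assms(1) in simp)

lemma norm_op_pow_subst_op:
  assumes n: "n \<ge> 1 \<or> (acc_points :: 'a set) \<noteq> {}"
  shows "norm (op_pow (subst_op \<tau>) n) = real (max_size n)"
proof (rule antisym)
  note app = op_pow_subst_op[OF compact_UNIV substitution]
  show "norm (op_pow (subst_op \<tau>) n) \<le> real (max_size n)"
  proof (rule norm_blinfun_bound)
    fix f
    show "norm (op_pow (subst_op \<tau>) n f) \<le> real (max_size n) * norm f"
    proof (rule norm_bound)
      fix a
      have "\<bar>\<Sum>b\<in>#subst_iter \<tau> n a. apply_bcontfun f b\<bar> \<le> real (size (subst_iter \<tau> n a)) * norm f"
        by (rule sum_mset_abs_le[OF abs_apply_bcontfun_le])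
      also have "\<dots> \<le> real (max_size n) * norm f"
        using size_subst_iter_le_max_size[OF n] by (intro mult_right_mono) auto
      finally show "norm (apply_bcontfun (op_pow (subst_op \<tau>) n f) a) \<le> real (max_size n) * norm f"
        by (simp add: app)
    qed
  qed simp
  show "real (max_size n) \<le> norm (op_pow (subst_op \<tau>) n)"
  proof (rule max_size_le_real)
    fix p :: 'a
    let ?one = "const_bcontfun 1 :: 'a \<Rightarrow>\<^sub>C real"
    have "real (size (subst_iter \<tau> n p)) = \<bar>apply_bcontfun (op_pow (subst_op \<tau>) n ?one) p\<bar>"
      by (simp add: app const_bcontfun.rep_eq)
    also have "\<dots> \<le> norm (op_pow (subst_op \<tau>) n ?one)" by (rule abs_apply_bcontfun_le)
    also have "\<dots> \<le> norm (op_pow (subst_op \<tau>) n) * norm ?one" by (rule norm_blinfun)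
    also have "\<dots> \<le> norm (op_pow (subst_op \<tau>) n)"
      by (intro mult_left_le norm_bound) (auto simp: const_bcontfun.rep_eq)
    finally show "real (size (subst_iter \<tau> n p)) \<le> norm (op_pow (subst_op \<tau>) n)" .
  qed simp
qed

lemma apply_acc_fun_Acc_fun:
  fixes f :: "'a \<Rightarrow> real"
  assumes "\<And>a. a \<notin> acc_points \<Longrightarrow> f a = 0"
  shows "apply_acc_fun (Acc_fun f) = f"
proof -
  have "range f \<subseteq> insert 0 (f ` acc_points)" using assms by auto
  then have "bounded (range f)"
    using finite_acc by (intro bounded_subset[OF finite_imp_bounded]) auto
  then show ?thesis
    using assms finite_acc by (intro Acc_fun_inverse) (simp add: continuous_on_finite)
qed

lemma norm_op_pow_acc_subst_op: "norm (op_pow (acc_subst_op \<tau>) n) = real (max_size n)"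
proof (rule antisym)
  note app = op_pow_acc_subst_op[OF finite_acc, of \<tau>]
  show "norm (op_pow (acc_subst_op \<tau>) n) \<le> real (max_size n)"
  proof (rule norm_blinfun_bound)
    fix f
    show "norm (op_pow (acc_subst_op \<tau>) n f) \<le> real (max_size n) * norm f"
    proof (rule norm_acc_fun_le)
      fix a
      show "\<bar>apply_acc_fun (op_pow (acc_subst_op \<tau>) n f) a\<bar> \<le> real (max_size n) * norm f"
      proof (cases "a \<in> acc_points")
        case True
        have "\<bar>\<Sum>b\<in>#subst_iter \<tau> n a. apply_acc_fun f b\<bar> \<le> real (size (subst_iter \<tau> n a)) * norm f"
          by (rule sum_mset_abs_le[OF abs_apply_acc_fun_le])
        also have "\<dots> \<le> real (max_size n) * norm f"
          using size_le_max_size[OF True] by (intro mult_right_mono) auto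
        finally show ?thesis by (simp add: app subst_iter_acc_subst[OF True])
      next
        case False
        then have "apply_acc_fun (op_pow (acc_subst_op \<tau>) n f) a = 0"
          using apply_acc_fun[of "op_pow (acc_subst_op \<tau>) n f"] by auto
        then show ?thesis by simp
      qed
    qed
  qed simp
  show "real (max_size n) \<le> norm (op_pow (acc_subst_op \<tau>) n)"
  proof (rule max_size_le_real)
    fix p :: 'a assume p: "p \<in> acc_points"
    \<comment> \<open>Elements of \<open>acc_fun\<close> vanish off the accumulation points, so this
      indicator represents the constant function 1.\<close>
    define one where "one = Acc_fun (indicator acc_points :: 'a \<Rightarrow> real)"
    have one: "apply_acc_fun one = indicator acc_points"
      unfolding one_def by (rule apply_acc_fun_Acc_fun) simp
    have "(\<Sum>b\<in>#subst_iter \<tau> n p. indicator acc_points b :: real) = (\<Sum>b\<in>#subst_iter \<tau> n p. 1)"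
      using letter_of_subst_iter_acc_point[OF p]
      by (intro arg_cong[of _ _ sum_mset] image_mset_cong) simp
    then have "real (size (subst_iter \<tau> n p)) = \<bar>apply_acc_fun (op_pow (acc_subst_op \<tau>) n one) p\<bar>"
      by (simp add: app one subst_iter_acc_subst[OF p])
    also have "\<dots> \<le> norm (op_pow (acc_subst_op \<tau>) n one)" by (rule abs_apply_acc_fun_le)
    also have "\<dots> \<le> norm (op_pow (acc_subst_op \<tau>) n) * norm one" by (rule norm_blinfun)
    also have "\<dots> \<le> norm (op_pow (acc_subst_op \<tau>) n)"
      by (intro mult_left_le norm_acc_fun_le) (auto simp: one indicator_def)
    finally show "real (size (subst_iter \<tau> n p)) \<le> norm (op_pow (acc_subst_op \<tau>) n)" .
  qed simp
qed

section \<open>Spectral radii\<close>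

text \<open>The norms of the powers of both operators coincide for n \<ge> 1, so a single
  application of Fekete's lemma serves both.\<close>

lemma root_norm_op_pow_convergent:
  obtains \<rho> where "0 \<le> \<rho>" "(\<lambda>n. root n (norm (op_pow (subst_op \<tau>) n))) \<longlonglongrightarrow> \<rho>"
    "(\<lambda>n. root n (norm (op_pow (acc_subst_op \<tau>) n))) \<longlonglongrightarrow> \<rho>"
proof -
  define \<rho> where "\<rho> = (INF n\<in>{1..}. root n (norm (op_pow (subst_op \<tau>) n)))"
  have lim: "(\<lambda>n. root n (norm (op_pow (subst_op \<tau>) n))) \<longlonglongrightarrow> \<rho>"
    unfolding \<rho>_def
    by (rule root_submultiplicative_convergent) (auto simp: op_pow_add norm_blinfun_compose)
  have "eventually (\<lambda>n. root n (norm (op_pow (subst_op \<tau>) n)) =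
      root n (norm (op_pow (acc_subst_op \<tau>) n))) sequentially"
    using eventually_ge_at_top[of 1]
    by eventually_elim (simp add: norm_op_pow_subst_op norm_op_pow_acc_subst_op)
  with lim have "(\<lambda>n. root n (norm (op_pow (acc_subst_op \<tau>) n))) \<longlonglongrightarrow> \<rho>"
    by (rule Lim_transform_eventually)
  moreover have "0 \<le> \<rho>"
    by (rule LIMSEQ_le_const[OF lim]) (auto intro!: exI[of _ 0] real_root_ge_zero)
  ultimately show ?thesis using that lim by blast
qed

text \<open>One \<open>z\<close> serves both operators: the functional built from \<open>w\<close>
  sees only values at accumulation points, where \<open>acc_subst \<tau>\<close> agrees with
  \<tau>.\<close>

lemma dominant_spectral_value:
  assumes "(acc_points :: 'a set) \<noteq> {}"
    and lim: "(\<lambda>n. root n (norm (op_pow (subst_op \<tau>) n))) \<longlonglongrightarrow> \<rho>"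
  obtains z where "\<rho> \<le> cmod z" "z \<in> op_spectrum (subst_op \<tau>)" "z \<in> op_spectrum (acc_subst_op \<tau>)"
proof -
  have count_Suc: "real (count (subst_iter \<tau> (Suc k) p) q) =
      (\<Sum>l\<in>acc_points. real (count (subst_iter \<tau> k p) l) * real (count (\<tau> l) q))"
    if "p \<in> acc_points" for k p q
  proof -
    have "count (subst_iter \<tau> (Suc k) p) q = (\<Sum>l\<in>acc_points. count (subst_iter \<tau> k p) l * count (\<tau> l) q)"
      unfolding subst_iter_Suc_left count_sum_mset
      using letter_of_subst_iter_acc_point[OF that]
      by (subst sum_mset_eq_sum_count[OF finite_acc]) auto
    then show ?thesis by simp
  qed
  obtain z :: complex and w where w: "\<exists>p\<in>acc_points. w p \<noteq> 0"
    "\<And>q. q \<in> acc_points \<Longrightarrow> (\<Sum>p\<in>acc_points. w p * of_real (real (count (\<tau> p) q))) = z * w q"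
    "\<And>c. c > cmod z \<Longrightarrow> \<exists>C. \<forall>k. \<forall>p\<in>acc_points. \<forall>q\<in>acc_points.
        \<bar>real (count (subst_iter \<tau> k p) q)\<bar> \<le> C * c ^ k"
    by (rule dominant_left_eigenvector[OF finite_acc assms(1),
          of "\<lambda>k p q. real (count (subst_iter \<tau> k p) q)" "\<lambda>p q. real (count (\<tau> p) q)"])
      (auto simp: count_Suc)
  have "\<rho> \<le> c" if c: "c > cmod z" for c
  proof -
    have "c > 0" using c norm_ge_zero[of z] by linarith
    obtain C where C: "\<And>k p q. p \<in> acc_points \<Longrightarrow> q \<in> acc_points \<Longrightarrow>
        real (count (subst_iter \<tau> k p) q) \<le> C * c ^ k"
      using w(3)[OF c] by auto
    \<comment> \<open>A length is a sum of \<open>card acc_points\<close> counts, each at most C *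
      c^n. The maximum with 1 makes the n-th root of \<open>K\<close> tend to 1, so the roots of the
      norms have a limit at most c.\<close>
    define K where "K = max 1 (real (card (acc_points :: 'a set)) * C)"
    have le: "norm (op_pow (subst_op \<tau>) n) \<le> K * c ^ n" for n
    proof -
      have "real (size (subst_iter \<tau> n p)) \<le> K * c ^ n" if "p \<in> acc_points" for p
      proof -
        have "real (size (subst_iter \<tau> n p)) = (\<Sum>q\<in>acc_points. real (count (subst_iter \<tau> n p) q))"
        proof -
          have "size (subst_iter \<tau> n p) = (\<Sum>q\<in>acc_points. count (subst_iter \<tau> n p) q)"
            using sum_mset_eq_sum_count[OF finite_acc, of "subst_iter \<tau> n p" "\<lambda>_. 1 :: nat"]
              letter_of_subst_iter_acc_point[OF that] by auto
          then show ?thesis by simp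
        qed
        also have "\<dots> \<le> (\<Sum>q\<in>(acc_points :: 'a set). C * c ^ n)"
          using that by (intro sum_mono C)
        also have "\<dots> \<le> K * c ^ n"
          using \<open>c > 0\<close> by (simp add: K_def mult_right_mono flip: mult.assoc)
        finally show ?thesis .
      qed
      then have "real (max_size n) \<le> K * c ^ n"
        using \<open>c > 0\<close> by (intro max_size_le_real) (auto simp: K_def)
      then show ?thesis using assms(1) by (simp add: norm_op_pow_subst_op)
    qed
    have "(\<lambda>n. root n K * c) \<longlonglongrightarrow> 1 * c"
      by (intro tendsto_intros LIMSEQ_root_const) (simp add: K_def)
    then have lim': "(\<lambda>n. root n K * c) \<longlonglongrightarrow> c" by simp
    have "root n (norm (op_pow (subst_op \<tau>) n)) \<le> root n K * c" if "n \<ge> 1" for n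
    proof -
      have "root n (norm (op_pow (subst_op \<tau>) n)) \<le> root n (K * c ^ n)" using le that by simp
      also have "\<dots> = root n K * c"
        using that \<open>c > 0\<close> by (simp add: real_root_mult real_root_power_cancel)
      finally show ?thesis .
    qed
    then show "\<rho> \<le> c" by (intro LIMSEQ_le[OF lim lim']) blast
  qed
  then have "\<rho> \<le> cmod z" by (rule dense_ge)
  \<comment> \<open>The left eigenvector equation, read on functions after interchanging the sums
    over p and q.\<close>
  have functional: "(\<Sum>p\<in>acc_points. w p * of_real (\<Sum>b\<in>#\<tau> p. f b)) = z * (\<Sum>p\<in>acc_points. w p * of_real (f p))"
    for f :: "'a \<Rightarrow> real"
  proof -
    have "(\<Sum>p\<in>acc_points. w p * of_real (\<Sum>b\<in>#\<tau> p. f b)) =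
        (\<Sum>p\<in>acc_points. w p * of_real (\<Sum>q\<in>acc_points. real (count (\<tau> p) q) * f q))"
      using letter_of_acc_point
      by (intro sum.cong refl, subst sum_mset_eq_sum_count[OF finite_acc]) auto
    also have "\<dots> = (\<Sum>q\<in>acc_points. (\<Sum>p\<in>acc_points. w p * of_real (real (count (\<tau> p) q))) * of_real (f q))"
      by (simp add: sum_distrib_left sum_distrib_right mult_ac) (rule sum.swap)
    also have "\<dots> = z * (\<Sum>p\<in>acc_points. w p * of_real (f p))"
      unfolding sum_distrib_left by (intro sum.cong refl) (simp only: w(2) mult.assoc)
    finally show ?thesis .
  qed
  obtain p0 where p0: "p0 \<in> acc_points" "w p0 \<noteq> 0" using w(1) by blast
  \<comment> \<open>A function that is 1 at \<open>p0\<close> and 0 at the other accumulation points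
    witnesses that the functional is non-zero.\<close>
  have point: "(\<Sum>p\<in>acc_points. w p * of_real (f p)) = w p0"
    if "f p0 = 1" "\<And>q. q \<in> acc_points - {p0} \<Longrightarrow> f q = 0" for f :: "'a \<Rightarrow> real"
    using that p0(1) finite_acc by (subst sum.remove[OF finite_acc p0(1)]) auto
  show ?thesis
  proof (rule that[OF \<open>\<rho> \<le> cmod z\<close>])
    obtain f :: "'a \<Rightarrow>\<^sub>C real" where f: "apply_bcontfun f p0 = 1"
      "\<And>q. q \<in> acc_points - {p0} \<Longrightarrow> apply_bcontfun f q = 0"
      using separating_bcontfun[OF compact_UNIV, of "acc_points - {p0}" p0] finite_acc by blast
    show "z \<in> op_spectrum (subst_op \<tau>)"
    proof (rule in_op_spectrum_of_left_eigenfunctional)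
      show "(\<Sum>p\<in>acc_points. w p * of_real (apply_bcontfun f p)) \<noteq> 0"
        using point[of "apply_bcontfun f", OF f] p0 by simp
      show "(\<Sum>p\<in>acc_points. w p * of_real (apply_bcontfun (subst_op \<tau> h) p)) =
          z * (\<Sum>p\<in>acc_points. w p * of_real (apply_bcontfun h p))" for h
        unfolding subst_op_apply[OF compact_UNIV substitution] by (rule functional)
    qed (simp_all add: plus_bcontfun.rep_eq scaleR_bcontfun.rep_eq distrib_left sum.distrib
        sum_distrib_left mult_ac)
    define g where "g = Acc_fun (indicator {p0} :: 'a \<Rightarrow> real)"
    have g: "apply_acc_fun g = indicator {p0}"
      unfolding g_def using p0 by (intro apply_acc_fun_Acc_fun) (auto simp: indicator_def)
    show "z \<in> op_spectrum (acc_subst_op \<tau>)"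
    proof (rule in_op_spectrum_of_left_eigenfunctional)
      show "(\<Sum>p\<in>acc_points. w p * of_real (apply_acc_fun g p)) \<noteq> 0"
        using point[of "apply_acc_fun g"] p0 by (simp add: g)
      have "(\<Sum>p\<in>acc_points. w p * of_real (apply_acc_fun (acc_subst_op \<tau> h) p)) =
          (\<Sum>p\<in>acc_points. w p * of_real (\<Sum>b\<in>#\<tau> p. apply_acc_fun h b))" for h
        by (intro sum.cong refl) (simp only: acc_subst_op_apply[OF finite_acc] acc_subst_def if_True)
      then show "(\<Sum>p\<in>acc_points. w p * of_real (apply_acc_fun (acc_subst_op \<tau> h) p)) =
          z * (\<Sum>p\<in>acc_points. w p * of_real (apply_acc_fun h p))" for h
        unfolding functional by simp
    qed (simp_all add: plus_acc_fun.rep_eq scaleR_acc_fun.rep_eq distrib_left sum.distrib sum_distrib_left mult_ac)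
  qed
qed

lemma op_spectral_radius_eq:
  assumes "(\<lambda>n. root n (norm (op_pow (subst_op \<tau>) n))) \<longlonglongrightarrow> \<rho>"
  shows "op_spectral_radius (subst_op \<tau>) = \<rho>" "op_spectral_radius (acc_subst_op \<tau>) = \<rho>"
proof -
  obtain \<rho>' where \<rho>': "0 \<le> \<rho>'" "(\<lambda>n. root n (norm (op_pow (subst_op \<tau>) n))) \<longlonglongrightarrow> \<rho>'"
    "(\<lambda>n. root n (norm (op_pow (acc_subst_op \<tau>) n))) \<longlonglongrightarrow> \<rho>'"
    by (rule root_norm_op_pow_convergent)
  have "\<rho>' = \<rho>" using LIMSEQ_unique[OF \<rho>'(2) assms] .
  note \<rho> = \<rho>'[unfolded this]
  \<comment> \<open>Without accumulation points there is no eigenvalue to use, but the operator on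
    the zero space has all its powers of norm 0.\<close>
  have zero: "\<rho> = 0" if "(acc_points :: 'a set) = {}"
  proof -
    have "max_size n = 0" for n by (simp add: max_size_def that)
    then show ?thesis using \<rho>(3) by (simp add: norm_op_pow_acc_subst_op LIMSEQ_const_iff)
  qed
  have "\<rho> = 0 \<or> (\<exists>z. \<rho> \<le> cmod z \<and> z \<in> op_spectrum (subst_op \<tau>) \<and> z \<in> op_spectrum (acc_subst_op \<tau>))"
    using zero dominant_spectral_value[OF _ assms] by metis
  then show "op_spectral_radius (subst_op \<tau>) = \<rho>" "op_spectral_radius (acc_subst_op \<tau>) = \<rho>"
    using \<rho>(1) op_spectrum_cmod_le[OF bcontfun_Cauchy_convergent \<rho>(2)]
      op_spectrum_cmod_le[OF acc_fun_Cauchy_convergent \<rho>(3)]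
    by (auto intro!: op_spectral_radius_eqI)
qed

text \<open>\<open>lim\<close> is meaningful only for convergent sequences; convergence follows from
  submultiplicativity of the essential norm.\<close>

lemma ess_radius_lim:
  obtains r where "(\<lambda>n. root n (ess_norm (op_pow (subst_op \<tau>) n))) \<longlonglongrightarrow> r" "ess_radius (subst_op \<tau>) = r"
proof -
  have "(\<lambda>n. root n (ess_norm (op_pow (subst_op \<tau>) n))) \<longlonglongrightarrow>
      (INF n\<in>{1..}. root n (ess_norm (op_pow (subst_op \<tau>) n)))"
    by (rule root_submultiplicative_convergent) (auto simp: op_pow_add ess_norm_compose ess_norm_nonneg)
  then show ?thesis using that unfolding ess_radius_def by (metis limI)
qed

section \<open>The lower bound for the essential norm\<close>

text \<open>A neighbourhood consisting only of accumulation points would be finite; removing the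
  others would leave {p} open.\<close>

lemma isolated_in_neighbourhood:
  fixes p :: 'a
  assumes "p \<in> acc_points" "open V" "p \<in> V"
  shows "\<exists>a\<in>V. isolated a"
proof (rule ccontr)
  assume "\<not> (\<exists>a\<in>V. isolated a)"
  then have "V \<subseteq> acc_points" by (auto simp: acc_points_def)
  then have "open (V - (acc_points - {p}))"
    using finite_acc assms(2) by (intro open_Diff finite_imp_closed) auto
  moreover have "V - (acc_points - {p}) = {p}" using \<open>V \<subseteq> acc_points\<close> assms(3) by auto
  ultimately show False using assms(1) by (simp add: acc_points_def isolated_def)
qed

lemma isolated_letters_subst_iter:
  assumes "\<forall>a. isolated a \<longrightarrow> (\<forall>b. b \<in># \<tau> a \<longrightarrow> isolated b)" "isolated a" "b \<in># subst_iter \<tau> n a"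
  shows "isolated b"
  using assms(2,3) by (induction n arbitrary: a) (use assms(1) in \<open>auto simp: subst_iter_Suc\<close>)

text \<open>Near p the length of the n-th image is that of p, and no letter of \<open>B\<close>
  occurs, because the n-th image of p contains only accumulation points and both counts are locally
  constant.\<close>

lemma isolated_word_avoiding:
  assumes p: "p \<in> acc_points"
    and iso: "\<And>V. open V \<Longrightarrow> p \<in> V \<Longrightarrow> \<exists>a\<in>V. \<forall>b. b \<in># subst_iter \<tau> n a \<longrightarrow> isolated b"
    and B: "finite B" "\<And>b. b \<in> B \<Longrightarrow> isolated b"
  obtains a where "size (subst_iter \<tau> n a) = size (subst_iter \<tau> n p)"
    "\<And>b. b \<in># subst_iter \<tau> n a \<Longrightarrow> isolated b" "set_mset (subst_iter \<tau> n a) \<inter> B = {}"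
proof -
  define V where "V = {a. size (subst_iter \<tau> n a) = size (subst_iter \<tau> n p)} \<inter>
    {a. size {#b \<in># subst_iter \<tau> n a. b \<in> B#} = 0}"
  have "open V" unfolding V_def
    by (intro open_Int open_size_subst_iter_eq open_size_filter_eq B)
  moreover have "p \<in> V"
    using letter_of_subst_iter_acc_point[OF p] B(2) by (auto simp: V_def acc_points_def)
  ultimately obtain a where "a \<in> V" "\<forall>b. b \<in># subst_iter \<tau> n a \<longrightarrow> isolated b"
    using iso by blast
  then show ?thesis by (intro that[of a]) (auto simp: V_def)
qed

text \<open>Points are chosen one after another, each with an image avoiding the finitely many
  isolated letters that occurred before.\<close>

lemma disjoint_isolated_words:
  assumes p: "p \<in> acc_points"
    and iso: "\<And>V. open V \<Longrightarrow> p \<in> V \<Longrightarrow> \<exists>a\<in>V. \<forall>b. b \<in># subst_iter \<tau> n a \<longrightarrow> isolated b"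
  obtains s :: "nat \<Rightarrow> 'a" where
    "\<And>k. size (subst_iter \<tau> n (s k)) = size (subst_iter \<tau> n p)"
    "\<And>k b. b \<in># subst_iter \<tau> n (s k) \<Longrightarrow> isolated b"
    "\<And>k l. k \<noteq> l \<Longrightarrow> set_mset (subst_iter \<tau> n (s k)) \<inter> set_mset (subst_iter \<tau> n (s l)) = {}"
proof -
  let ?W = "\<lambda>a. set_mset (subst_iter \<tau> n a)"
  define good where "good a \<longleftrightarrow> size (subst_iter \<tau> n a) = size (subst_iter \<tau> n p) \<and> (\<forall>b\<in>?W a. isolated b)" for a
  \<comment> \<open>A state pairs the current point with a finite set collecting the letters of all
    images so far; \<open>Q\<close> says that the set grows and the new image avoids it.\<close>
  define P where "P x \<longleftrightarrow> good (fst x) \<and> finite (snd x) \<and> (\<forall>b\<in>snd x. isolated b) \<and> ?W (fst x) \<subseteq> snd x"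
    for x :: "'a \<times> 'a set"
  define Q where "Q x y \<longleftrightarrow> snd x \<subseteq> snd y \<and> ?W (fst y) \<inter> snd x = {}" for x y :: "'a \<times> 'a set"
  have avoid: "\<exists>a. good a \<and> ?W a \<inter> B = {}" if "finite B" "\<forall>b\<in>B. isolated b" for B
  proof (rule isolated_word_avoiding[OF p iso that(1)])
    fix a assume "size (subst_iter \<tau> n a) = size (subst_iter \<tau> n p)"
      "\<And>b. b \<in># subst_iter \<tau> n a \<Longrightarrow> isolated b" "?W a \<inter> B = {}"
    then show ?thesis unfolding good_def by blast
  qed (use that in auto)
  have "\<exists>f. \<forall>k. P (f k) \<and> Q (f k) (f (Suc k))"
  proof (rule dependent_nat_choice)
    obtain a where "good a" using avoid[of "{}"] by auto
    then have "P (a, ?W a)" by (auto simp: P_def good_def)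
    then show "\<exists>x. P x" ..
    fix x :: "'a \<times> 'a set" and k :: nat assume "P x"
    then obtain a where "good a" "?W a \<inter> snd x = {}" using avoid[of "snd x"] by (auto simp: P_def)
    then have "P (a, snd x \<union> ?W a) \<and> Q x (a, snd x \<union> ?W a)"
      using \<open>P x\<close> by (auto simp: P_def Q_def good_def)
    then show "\<exists>y. P y \<and> Q x y" ..
  qed
  then obtain f where f: "\<And>k. P (f k)" "\<And>k. Q (f k) (f (Suc k))" by blast
  have mono: "snd (f k) \<subseteq> snd (f l)" if "k \<le> l" for k l
    using lift_Suc_mono_le[of "\<lambda>k. snd (f k)", OF _ that] f(2) by (simp add: Q_def)
  have disj: "?W (fst (f k)) \<inter> ?W (fst (f l)) = {}" if less: "k < l" for k l
  proof -
    obtain m where "l = Suc m" "k \<le> m" using less by (cases l) auto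
    then show ?thesis using f(1)[of k] f(2)[of m] mono[of k m] unfolding P_def Q_def by blast
  qed
  show ?thesis
  proof (rule that[of "\<lambda>k. fst (f k)"])
    show "?W (fst (f k)) \<inter> ?W (fst (f l)) = {}" if "k \<noteq> l" for k l
      using disj[of k l] disj[of l k] that by (metis Int_commute linorder_neqE_nat)
  qed (use f(1) in \<open>auto simp: P_def good_def\<close>)
qed

text \<open>With \<open>f k\<close> the indicator of the letters of \<open>\<tau>\<^sup>n (s k)\<close>, the function \<open>f k - f l\<close> has norm at most
  1 and is mapped by \<open>M\<^sup>n\<close> to a function of maximal value at \<open>s k\<close>, whereas a compact operator makes
  it arbitrarily small for suitable \<open>k \<noteq> l\<close>.\<close>

lemma size_le_ess_norm:
  assumes p: "p \<in> acc_points"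
    and iso: "\<And>V. open V \<Longrightarrow> p \<in> V \<Longrightarrow> \<exists>a\<in>V. \<forall>b. b \<in># subst_iter \<tau> n a \<longrightarrow> isolated b"
  shows "real (size (subst_iter \<tau> n p)) \<le> ess_norm (op_pow (subst_op \<tau>) n)"
proof (rule ess_norm_greatest)
  fix V :: "('a \<Rightarrow>\<^sub>C real) \<Rightarrow>\<^sub>L ('a \<Rightarrow>\<^sub>C real)" assume V: "compact_op V"
  let ?M = "op_pow (subst_op \<tau>) n" and ?N = "real (size (subst_iter \<tau> n p))"
  obtain s :: "nat \<Rightarrow> 'a" where s:
    "\<And>k. size (subst_iter \<tau> n (s k)) = size (subst_iter \<tau> n p)"
    "\<And>k b. b \<in># subst_iter \<tau> n (s k) \<Longrightarrow> isolated b"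
    "\<And>k l. k \<noteq> l \<Longrightarrow> set_mset (subst_iter \<tau> n (s k)) \<inter> set_mset (subst_iter \<tau> n (s l)) = {}"
    using disjoint_isolated_words[OF p iso] by blast
  let ?W = "\<lambda>k. set_mset (subst_iter \<tau> n (s k))"
  define f where "f k = Bcontfun (indicator (?W k) :: 'a \<Rightarrow> real)" for k
  have f: "apply_bcontfun (f k) = indicator (?W k)" for k
    unfolding f_def using s(2)
    by (intro bcontfun_of_continuous compact_UNIV continuous_indicator_isolated) auto
  have "norm (f k) \<le> 1" for k by (rule norm_bound) (simp add: f indicator_def)
  then have "V (f k) \<in> closure (blinfun_apply V ` cball 0 1)" for k
    using closure_subset by fastforce
  \<comment> \<open>The images of the indicators lie in a compact set, so along a subsequence two
    consecutive ones are as close as desired.\<close>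
  then obtain h r where r: "strict_mono r" and h: "((\<lambda>k. V (f k)) \<circ> r) \<longlonglongrightarrow> h"
    using V unfolding compact_op_def compact_eq_seq_compact_metric seq_compact_def by metis
  show "?N \<le> norm (?M - V)"
  proof (rule field_le_epsilon)
    fix e :: real assume "0 < e"
    then obtain N where "\<forall>k\<ge>N. \<forall>l\<ge>N. dist (V (f (r k))) (V (f (r l))) < e"
      using LIMSEQ_imp_Cauchy[OF h] unfolding Cauchy_def by auto
    then have N: "dist (V (f (r N))) (V (f (r (Suc N)))) < e" using le_SucI by blast
    define k l where "k = r N" and "l = r (Suc N)"
    have "k \<noteq> l" using r strict_mono_eq unfolding k_def l_def by fastforce
    define g where "g = f k - f l"
    have g: "apply_bcontfun g b = indicator (?W k) b - indicator (?W l) b" for b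
      by (simp add: g_def f minus_bcontfun.rep_eq)
    have "norm g \<le> 1" by (rule norm_bound) (auto simp: g indicator_def)
    \<comment> \<open>By disjointness the second indicator vanishes on the letters of the image of
      \<open>s k\<close>, so \<open>g\<close> is 1 on all of them.\<close>
    have "(\<Sum>b\<in>#subst_iter \<tau> n (s k). apply_bcontfun g b) = (\<Sum>b\<in>#subst_iter \<tau> n (s k). 1)"
      using s(3)[OF \<open>k \<noteq> l\<close>]
      by (intro arg_cong[of _ _ sum_mset] image_mset_cong) (auto simp: g indicator_def)
    then have "?N = apply_bcontfun (?M g) (s k)"
      by (simp add: op_pow_subst_op[OF compact_UNIV substitution] s(1))
    also have "\<dots> \<le> norm (?M g)"
      using abs_apply_bcontfun_le[of "?M g" "s k"] by simp
    also have "?M g = (?M - V) g + (V (f k) - V (f l))"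
      by (simp add: g_def blinfun.diff_left blinfun.diff_right)
    also have "norm \<dots> \<le> norm (?M - V) * norm g + norm (V (f k) - V (f l))"
      by (intro order_trans[OF norm_triangle_ineq] add_right_mono norm_blinfun)
    also have "\<dots> \<le> norm (?M - V) + e"
      using N \<open>norm g \<le> 1\<close> by (intro add_mono mult_left_le) (auto simp: k_def l_def dist_norm)
    finally show "?N \<le> norm (?M - V) + e" .
  qed
qed

lemma ess_norm_eq_norm:
  assumes n: "n \<ge> 1 \<or> (acc_points :: 'a set) \<noteq> {}"
    and iso: "\<And>p V. p \<in> acc_points \<Longrightarrow> open V \<Longrightarrow> p \<in> V \<Longrightarrow>
      \<exists>a\<in>V. \<forall>b. b \<in># subst_iter \<tau> n a \<longrightarrow> isolated b"
  shows "ess_norm (op_pow (subst_op \<tau>) n) = norm (op_pow (subst_op \<tau>) n)"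
proof (rule antisym[OF ess_norm_le_norm])
  show "norm (op_pow (subst_op \<tau>) n) \<le> ess_norm (op_pow (subst_op \<tau>) n)"
    unfolding norm_op_pow_subst_op[OF n]
    using iso by (intro max_size_le_real ess_norm_nonneg size_le_ess_norm)
qed

end

section \<open>From the definition of reduced substitutions to the norm and spectral
  statements\<close>

lemma infty_reduced_imp_reduced_substitution:
  fixes \<tau> :: "'a::t2_space \<Rightarrow> 'a multiset"
  assumes "compact (UNIV :: 'a set)" "finite (acc_points :: 'a set)" "substitution \<tau>" "infty_reduced \<tau>"
  shows "\<exists>U. reduced_substitution \<tau> U"
  using assms unfolding infty_reduced_def
proof (elim exE conjE, intro exI)
  fix U :: "'a \<Rightarrow> 'a set"
  assume "\<forall>p\<in>acc_points. open (U p) \<and> p \<in> U p"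
    "\<forall>a. a \<notin> (\<Union>p\<in>acc_points. U p) \<longrightarrow> \<tau> a = {#}"
    "\<forall>p\<in>acc_points. \<forall>b. \<not> (\<exists>U'. open U' \<and> p \<in> U' \<and> U' \<subseteq> U p \<and> (\<forall>u\<in>U'. b \<in># \<tau> u))"
    "\<forall>p\<in>acc_points. \<forall>a\<in>U p. size (\<tau> a) \<le> size (\<tau> p)"
    "\<forall>p\<in>acc_points. \<forall>q\<in>acc_points. \<forall>u\<in>U p. size {#b \<in># \<tau> u. b \<in> U q#} \<le> count (\<tau> p) q"
  then show "reduced_substitution \<tau> U"
    unfolding reduced_substitution_def using assms(1-3) by (intro conjI)
qed

theorem theorem5p8:
  fixes \<tau> :: "'a::t2_space \<Rightarrow> 'a multiset"
  assumes "compact (UNIV :: 'a set)"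
    and "finite (acc_points :: 'a set)"
    and "substitution \<tau>"
    and "infty_reduced \<tau>"
  shows
    "(\<forall>n. n \<ge> 1 \<or> (acc_points :: 'a set) \<noteq> {} \<longrightarrow>
        ess_norm (op_pow (subst_op \<tau>) n) \<le> norm (op_pow (subst_op \<tau>) n) \<and>
        norm (op_pow (subst_op \<tau>) n) = norm (op_pow (acc_subst_op \<tau>) n) \<and>
        norm (op_pow (acc_subst_op \<tau>) n) =
          real (Max (insert 0 ((\<lambda>a. size (subst_iter (acc_subst \<tau>) n a)) ` acc_points)))) \<and>
     ess_radius (subst_op \<tau>) \<le> op_spectral_radius (subst_op \<tau>) \<and>
     op_spectral_radius (subst_op \<tau>) = op_spectral_radius (acc_subst_op \<tau>) \<and>
     ((\<forall>a. isolated a \<longrightarrow> (\<forall>b. b \<in># \<tau> a \<longrightarrow> isolated b)) \<or>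
      (\<forall>n\<ge>1. \<forall>p\<in>acc_points. \<forall>U. open U \<and> p \<in> U \<longrightarrow>
         (\<exists>a\<in>U. \<forall>b. b \<in># subst_iter \<tau> n a \<longrightarrow> isolated b)) \<longrightarrow>
      (\<forall>n. n \<ge> 1 \<or> (acc_points :: 'a set) \<noteq> {} \<longrightarrow>
         ess_norm (op_pow (subst_op \<tau>) n) = norm (op_pow (subst_op \<tau>) n)) \<and>
      ess_radius (subst_op \<tau>) = op_spectral_radius (acc_subst_op \<tau>))"
proof -
  obtain U where "reduced_substitution \<tau> U"
    using infty_reduced_imp_reduced_substitution[OF assms] by blast
  then interpret reduced_substitution \<tau> U .
  obtain \<rho> where \<rho>: "(\<lambda>n. root n (norm (op_pow (subst_op \<tau>) n))) \<longlonglongrightarrow> \<rho>"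
    by (rule root_norm_op_pow_convergent)
  obtain r where r: "(\<lambda>n. root n (ess_norm (op_pow (subst_op \<tau>) n))) \<longlonglongrightarrow> r"
    "ess_radius (subst_op \<tau>) = r"
    by (rule ess_radius_lim)
  have "r \<le> \<rho>"
    by (rule LIMSEQ_le[OF r(1) \<rho>]) (auto intro!: exI[of _ 1] simp: ess_norm_le_norm)
  have ess_eq: "ess_norm (op_pow (subst_op \<tau>) n) = norm (op_pow (subst_op \<tau>) n)"
    if hyp: "(\<forall>a. isolated a \<longrightarrow> (\<forall>b. b \<in># \<tau> a \<longrightarrow> isolated b)) \<or>
      (\<forall>n\<ge>1. \<forall>p\<in>acc_points. \<forall>U. open U \<and> p \<in> U \<longrightarrow>
         (\<exists>a\<in>U. \<forall>b. b \<in># subst_iter \<tau> n a \<longrightarrow> isolated b))"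
      and n: "n \<ge> 1 \<or> (acc_points :: 'a set) \<noteq> {}" for n
  proof (rule ess_norm_eq_norm[OF n])
    fix p :: 'a and V assume p: "p \<in> acc_points" "open V" "p \<in> V"
    then obtain a where a: "a \<in> V" "isolated a" using isolated_in_neighbourhood by blast
    show "\<exists>a\<in>V. \<forall>b. b \<in># subst_iter \<tau> n a \<longrightarrow> isolated b"
    \<comment> \<open>The hypothesis speaks of n \<ge> 1 only; for n = 0 the image of an isolated
      point near \<open>p\<close> is that point itself.\<close>
    proof (cases "n = 0")
      case False
      from hyp show ?thesis
      proof
        assume "\<forall>a. isolated a \<longrightarrow> (\<forall>b. b \<in># \<tau> a \<longrightarrow> isolated b)"
        with a show ?thesis using isolated_letters_subst_iter by blast
      next
        assume "\<forall>n\<ge>1. \<forall>p\<in>acc_points. \<forall>U. open U \<and> p \<in> U \<longrightarrow>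
          (\<exists>a\<in>U. \<forall>b. b \<in># subst_iter \<tau> n a \<longrightarrow> isolated b)"
        with p False show ?thesis by simp
      qed
    qed (use a in auto)
  qed
  have "r = \<rho>" if hyp: "(\<forall>a. isolated a \<longrightarrow> (\<forall>b. b \<in># \<tau> a \<longrightarrow> isolated b)) \<or>
      (\<forall>n\<ge>1. \<forall>p\<in>acc_points. \<forall>U. open U \<and> p \<in> U \<longrightarrow>
         (\<exists>a\<in>U. \<forall>b. b \<in># subst_iter \<tau> n a \<longrightarrow> isolated b))"
  proof (rule LIMSEQ_unique)
    \<comment> \<open>Norms and essential norms agree for all n \<ge> 1, so their roots have the
      same limit.\<close>
    show "(\<lambda>n. root n (ess_norm (op_pow (subst_op \<tau>) n))) \<longlonglongrightarrow> \<rho>"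
      using \<rho> by (rule Lim_transform_eventually)
        (use ess_eq[OF hyp] in \<open>auto intro: eventually_mono[OF eventually_ge_at_top[of 1]]\<close>)
  qed (rule r)
  then show ?thesis
    using ess_eq \<open>r \<le> \<rho>\<close> unfolding op_spectral_radius_eq[OF \<rho>] r(2)
    by (intro conjI allI impI ess_norm_le_norm)
      (simp_all only: norm_op_pow_subst_op norm_op_pow_acc_subst_op max_size_eq)
qed

end
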